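(* Let $\mathcal{A}$ be a tree-based sorting algorithm (i.e. a BST mergesort or a BT partition sort) which sorts the permutation $\pi$ of $\{1,\dots,n\}$ using $\mathcal{A}(\pi)$ accesses. Then $\mathrm{OPT}_{\mathrm{BST}}(\pi) \in O(\mathcal{A}(\pi))$.
   Context: BST model: the keys $\{1,\dots,n\}$ are stored in a binary search tree (BST). An access sequence $x_1,\dots,x_m$ is served in order; each search starts with a pointer at the root and at each step may move the pointer to the parent, left child or right child, or rotate the current node with its parent, each action at unit cost; the search must visit its key. An offline BST algorithm knows the whole sequence in advance. $\mathrm{OPT}_{\mathrm{BST}}(\pi)$ is the minimum cost of an offline BST algorithm serving the permutation $\pi$ viewed as an access sequence. A top tree of a binary tree $T$ is a connected set of nodes of $T$ containing the root; the subtrees of $T$ hanging off a top tree are the subtrees of $T$ rooted at children (outside $\tau$) of nodes of $\tau$. BST merge: given BSTs $T_A,T_B$ with disjoint keys, for some top trees $\tau_a$ of $T_A$ and $\tau_b$ of $T_B$ it returns a BST $T$ on the union of the keys such that for some top tree $\tau$ of $T$, $\tau=\tau_a\cup\tau_b$ (as key sets), the subtrees hanging off $\tau$ are unchanged subtrees of $T_A$ or $T_B$, and $\tau$ contains all block boundaries; here, listing the merged keys in sorted order, a block is a maximal contiguous run of keys coming from the same input tree, and block boundaries are the first and last keys of each block. Its number of accesses is $|\tau|$. BST mergesort: on an input sequence of size 1 it returns it (as a one-node BST); otherwise it splits the input sequence into two contiguous parts, each of size at least 1, sorts each part recursively by a BST mergesort, and applies a BST merge to the results. Its number of accesses is the sum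 of accesses over all merges. BT partition: given a binary tree (BT) $T$ (not ordered by key; its left-to-right order of keys represents input order), for some top tree $\tau$ of $T$ it returns two nonempty BTs $T_A,T_B$ with distinct keys such that for some top trees $\tau_a$ of $T_A$, $\tau_b$ of $T_B$, $\tau=\tau_a\cup\tau_b$, the other subtrees of $T$ appear unchanged in $T_A$ or $T_B$, $\tau$ contains the block boundaries of the partitioned output (blocks being maximal contiguous runs, in the left-to-right order of $T$, of keys sent to the same output), and the left-to-right orders of keys of $T_A$ and of $T_B$ are subsequences of that of $T$. Its number of accesses is $|\tau|$. BT partition sort: on a BT $T$ of size one it stops; otherwise it BT-partitions $T$ into $T_a,T_b$ such that for some key $k$ all keys of $T_a$ are $<k$ and all keys of $T_b$ are $\ge k$, recurses on both, and appends the results. It sorts $\pi$ when started on a BT whose left-to-right order of keys is $\pi$. Its number of accesses is the sum over all partitions. *)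

theory Defs
  imports Complex_Main "HOL-Library.Tree" "HOL-Library.Sublist"
begin

fun subt :: "'a tree \<Rightarrow> bool list \<Rightarrow> 'a tree" where
  "subt t [] = t"
| "subt Leaf (d # p) = Leaf"
| "subt (Node l a r) (d # p) = subt (if d then r else l) p"

fun upd_at :: "'a tree \<Rightarrow> bool list \<Rightarrow> 'a tree \<Rightarrow> 'a tree" where
  "upd_at t [] s = s"
| "upd_at Leaf (d # p) s = Leaf"
| "upd_at (Node l a r) (d # p) s =
     (if d then Node l a (upd_at r p s) else Node (upd_at l p s) a r)"

fun rot_up :: "'a tree \<Rightarrow> bool \<Rightarrow> 'a tree" where
  "rot_up (Node (Node ll b lr) a r) False = Node ll b (Node lr a r)"
| "rot_up (Node l a (Node rl b rr)) True = Node (Node l a rl) b rr"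
| "rot_up t d = t"

fun key_of :: "'a tree \<Rightarrow> 'a option" where
  "key_of Leaf = None"
| "key_of (Node l a r) = Some a"

text \<open>One unit-cost action of the pointer: move to parent, move to a child,
  or rotate the current node with its parent (the pointer stays on the node).\<close>
inductive bst_step :: "('a tree \<times> bool list) \<Rightarrow> ('a tree \<times> bool list) \<Rightarrow> bool" where
  up: "p \<noteq> [] \<Longrightarrow> bst_step (t, p) (t, butlast p)"
| down: "subt t (p @ [d]) \<noteq> Leaf \<Longrightarrow> bst_step (t, p) (t, p @ [d])"
| rot: "p \<noteq> [] \<Longrightarrow> subt t p \<noteq> Leaf \<Longrightarrow>
        bst_step (t, p) (upd_at t (butlast p) (rot_up (subt t (butlast p)) (last p)), butlast p)"

definition bst_search :: "'a tree \<Rightarrow> 'a \<Rightarrow> 'a tree \<Rightarrow> nat \<Rightarrow> bool" where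
  "bst_search t x t' k \<longleftrightarrow> t \<noteq> Leaf \<and>
     (\<exists>ss. length ss = Suc k \<and> hd ss = (t, []) \<and> fst (last ss) = t' \<and>
        (\<forall>i<k. bst_step (ss ! i) (ss ! Suc i)) \<and>
        (\<exists>s\<in>set ss. key_of (subt (fst s) (snd s)) = Some x))"

inductive bst_serves :: "'a tree \<Rightarrow> 'a list \<Rightarrow> nat \<Rightarrow> bool" where
  Nil: "bst_serves t [] 0"
| Cons: "bst_search t x t' k \<Longrightarrow> bst_serves t' xs c \<Longrightarrow> bst_serves t (x # xs) (k + c)"

definition OPT_BST :: "nat list \<Rightarrow> nat" where
  "OPT_BST xs = (LEAST c. \<exists>t. bst t \<and> set_tree t = set xs \<and> bst_serves t xs c)"

fun cut_top :: "'a set \<Rightarrow> 'a tree \<Rightarrow> 'a set" where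
  "cut_top S Leaf = {}"
| "cut_top S (Node l a r) = (if a \<in> S then {a} \<union> cut_top S l \<union> cut_top S r else {})"

text \<open>A top tree (as a key set; keys are distinct): nonempty, connected, containing the root.\<close>
definition is_top_tree :: "'a tree \<Rightarrow> 'a set \<Rightarrow> bool" where
  "is_top_tree T S \<longleftrightarrow> T \<noteq> Leaf \<and> S \<noteq> {} \<and> cut_top S T = S"

fun hanging :: "'a set \<Rightarrow> 'a tree \<Rightarrow> 'a tree set" where
  "hanging S Leaf = {}"
| "hanging S (Node l a r) = (if a \<in> S then hanging S l \<union> hanging S r else {Node l a r})"

definition block_bounds :: "'a list \<Rightarrow> ('a \<Rightarrow> bool) \<Rightarrow> 'a set" where
  "block_bounds xs f = {xs ! i | i. i < length xs \<and>
     (i = 0 \<or> f (xs ! (i - 1)) \<noteq> f (xs ! i) \<or>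
      i = length xs - 1 \<or> f (xs ! (i + 1)) \<noteq> f (xs ! i))}"

definition bst_merge :: "nat tree \<Rightarrow> nat tree \<Rightarrow> nat tree \<Rightarrow> nat \<Rightarrow> bool" where
  "bst_merge TA TB T c \<longleftrightarrow>
     bst TA \<and> bst TB \<and> set_tree TA \<inter> set_tree TB = {} \<and>
     bst T \<and> set_tree T = set_tree TA \<union> set_tree TB \<and>
     (\<exists>\<tau>a \<tau>b \<tau>. is_top_tree TA \<tau>a \<and> is_top_tree TB \<tau>b \<and> is_top_tree T \<tau> \<and>
        \<tau> = \<tau>a \<union> \<tau>b \<and>
        (\<forall>s\<in>hanging \<tau> T. s \<in> subtrees TA \<or> s \<in> subtrees TB) \<and>
        block_bounds (inorder T) (\<lambda>k. k \<in> set_tree TA) \<subseteq> \<tau> \<and>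
        c = card \<tau>)"

inductive msort :: "nat list \<Rightarrow> nat tree \<Rightarrow> nat \<Rightarrow> bool" where
  single: "msort [x] (Node Leaf x Leaf) 0"
| merge: "xs \<noteq> [] \<Longrightarrow> ys \<noteq> [] \<Longrightarrow> msort xs TA a \<Longrightarrow> msort ys TB b \<Longrightarrow>
          bst_merge TA TB T c \<Longrightarrow> msort (xs @ ys) T (a + b + c)"

definition bt_partition :: "nat tree \<Rightarrow> nat tree \<Rightarrow> nat tree \<Rightarrow> nat \<Rightarrow> bool" where
  "bt_partition T TA TB c \<longleftrightarrow>
     TA \<noteq> Leaf \<and> TB \<noteq> Leaf \<and> set_tree TA \<inter> set_tree TB = {} \<and>
     set_tree TA \<union> set_tree TB = set_tree T \<and>
     subseq (inorder TA) (inorder T) \<and> subseq (inorder TB) (inorder T) \<and>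
     (\<exists>\<tau>a \<tau>b \<tau>. is_top_tree TA \<tau>a \<and> is_top_tree TB \<tau>b \<and> is_top_tree T \<tau> \<and>
        \<tau> = \<tau>a \<union> \<tau>b \<and>
        (\<forall>s\<in>hanging \<tau> T. s \<in> subtrees TA \<or> s \<in> subtrees TB) \<and>
        block_bounds (inorder T) (\<lambda>k. k \<in> set_tree TA) \<subseteq> \<tau> \<and>
        c = card \<tau>)"

inductive psort :: "nat tree \<Rightarrow> nat \<Rightarrow> bool" where
  single: "psort (Node Leaf x Leaf) 0"
| split: "bt_partition T TA TB c \<Longrightarrow>
          (\<forall>a\<in>set_tree TA. a < k) \<Longrightarrow> (\<forall>b\<in>set_tree TB. k \<le> b) \<Longrightarrow>
          psort TA a \<Longrightarrow> psort TB b \<Longrightarrow> psort T (a + b + c)"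

end

theory Submission
  imports Defs
begin

text \<open>The argument is geometric. Put the keys on one axis and time on the other. For every merge
  node of a mergesort, working on a contiguous part of the input, draw its top tree as a row of
  points at the start of that part, at the split position and at its end. Block boundaries shield
  points of the two parts from each other, and the ancestor relations of the trees shield the rest,
  so the set of all points, of size linear in the number of accesses, is arborally satisfied.
  A satisfied set \<open>P\<close> is executed by a search tree at cost \<open>O(|P|)\<close>: keep a treap ordered by the
  time of next access and rearrange the accessed top tree through a right vine in linear time.
  Satisfiedness is invariant under transposition, and the transpose of a partition sort is a
  mergesort of the inverse permutation.\<close>

text \<open>The obstacle is that satisfaction of a part says nothing about points added later. Outer
  merges place their points on the boundary rows of the part, and each such point spans rectangles
  with the points inside. The induction therefore carries a second invariant,
  \<open>guarded\<close>, for both boundary rows. It need only speak of ancestor pairs: a key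
  outside the top tree that is not, in its input tree, a descendant of a given top key is separated
  from it by another top key, present in the same row. It survives a merge because an ancestor
  outside the top tree sits in a hanging subtree, which is copied unchanged from one input. The row
  at the split position belongs to both parts, so it shields each of them from the other and from
  the far boundary row.\<close>

section \<open>Restructuring a top tree\<close>

definition reach :: "nat \<Rightarrow> 'a tree \<Rightarrow> 'a tree \<Rightarrow> bool" where
  "reach n t t' \<longleftrightarrow> (\<exists>k\<le>n. (bst_step ^^ k) (t, []) (t', []))"

lemma reach_refl: "reach n t t"
  unfolding reach_def by (rule exI[of _ 0]) simp

lemma reach_trans: "reach m s t \<Longrightarrow> reach n t u \<Longrightarrow> reach (m + n) s u"
  unfolding reach_def using relpowp_trans add_mono by metis

lemma reach_mono: "reach m s t \<Longrightarrow> m \<le> n \<Longrightarrow> reach n s t"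
  unfolding reach_def using le_trans by blast

text \<open>Right children suffice: straightening rotates at the root and recurses into the right
  subtree alone.\<close>

lemma bst_step_right:
  assumes "bst_step s s'"
  shows "bst_step (Node l a (fst s), True # snd s) (Node l a (fst s'), True # snd s')"
  using assms
proof cases
  case (up p t)
  then show ?thesis using bst_step.up[of "True # p" "Node l a t"] by simp
next
  case (down t p d)
  then show ?thesis using bst_step.down[of "Node l a t" "True # p" d] by simp
next
  case (rot p t)
  then show ?thesis using bst_step.rot[of "True # p" "Node l a t"] by simp
qed

lemma bst_steps_right:
  assumes "(bst_step ^^ k) s s'"
  shows "(bst_step ^^ k) (Node l a (fst s), True # snd s) (Node l a (fst s'), True # snd s')"
  using assms
proof (induction k arbitrary: s')
  case 0
  then show ?case by simp
next
  case (Suc k)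
  then obtain u where "(bst_step ^^ k) s u" "bst_step u s'" by auto
  then show ?case using Suc.IH bst_step_right by (metis relpowp_Suc_I)
qed

lemma reach_right:
  assumes "reach n r r'" "r \<noteq> Leaf"
  shows "reach (n + 2) (Node l a r) (Node l a r')"
proof -
  obtain k where k: "k \<le> n" "(bst_step ^^ k) (r, []) (r', [])"
    using assms(1) by (auto simp: reach_def)
  have "bst_step (Node l a r, []) (Node l a r, [True])"
    using bst_step.down[of "Node l a r" "[]" True] assms(2) by simp
  then have "(bst_step ^^ Suc k) (Node l a r, []) (Node l a r', [True])"
    using bst_steps_right[OF k(2), of l a] by (metis fst_conv snd_conv relpowp_Suc_I2)
  moreover have "bst_step (Node l a r', [True]) (Node l a r', [])"
    using bst_step.up[of "[True]" "Node l a r'"] by simp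
  ultimately have "(bst_step ^^ Suc (Suc k)) (Node l a r, []) (Node l a r', [])"
    by (rule relpowp_Suc_I)
  then show ?thesis unfolding reach_def using k(1) by (intro exI[of _ "Suc (Suc k)"]) simp
qed

lemma reach_rotation:
  assumes "subt t [d] \<noteq> Leaf"
  shows "reach 2 t (rot_up t d)"
proof -
  have "bst_step (t, []) (t, [d])"
    using bst_step.down[of t "[]" d] assms by simp
  moreover have "bst_step (t, [d]) (rot_up t d, [])"
    using bst_step.rot[of "[d]" t] assms by simp
  ultimately have "(bst_step ^^ 2) (t, []) (rot_up t d, [])"
    by (auto simp: numeral_2_eq_2)
  then show ?thesis unfolding reach_def by blast
qed

text \<open>The top part of a tree cut at a key set \<open>S\<close> is recorded as the list of its keys in
  order, each paired with the hanging subtree to its left; the rightmost hanging subtree is kept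
  separately.\<close>

fun tops :: "'a set \<Rightarrow> 'a tree \<Rightarrow> ('a tree \<times> 'a) list"
  and rest :: "'a set \<Rightarrow> 'a tree \<Rightarrow> 'a tree" where
  "tops S Leaf = []"
| "tops S (Node l a r) = (if a \<in> S then tops S l @ (rest S l, a) # tops S r else [])"
| "rest S Leaf = Leaf"
| "rest S (Node l a r) = (if a \<in> S then rest S r else Node l a r)"

fun vine :: "('a tree \<times> 'a) list \<Rightarrow> 'a tree \<Rightarrow> 'a tree" where
  "vine [] h = h"
| "vine ((g, q) # xs) h = Node g q (vine xs h)"

lemma inorder_vine_append:
  "inorder (vine (ys @ (g, q) # zs) h) = inorder (vine ys g) @ q # inorder (vine zs h)"
  by (induction ys) auto

lemma inorder_vine_tops: "inorder (vine (tops S t) (rest S t)) = inorder t"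
  by (induction t) (auto simp: inorder_vine_append)

text \<open>Budget and induction measure in one. A key on the right spine is charged 2, one move
  down and one back up. A key left of the spine is charged 2 more for the rotation that brings it
  onto the spine, again one move down and the rotation itself. A rotation lowers the value by
  exactly 2.\<close>

fun straighten_cost :: "'a set \<Rightarrow> 'a tree \<Rightarrow> nat" where
  "straighten_cost S Leaf = 0"
| "straighten_cost S (Node l a r) =
     (if a \<in> S then 4 * length (tops S l) + 2 + straighten_cost S r else 0)"

lemma straighten_cost_le: "straighten_cost S t \<le> 4 * length (tops S t)"
  by (induction t) auto

lemma vine_eq_Leaf: "vine (tops S t) (rest S t) = Leaf \<longleftrightarrow> t = Leaf"
  by (metis inorder.simps(1) inorder_vine_tops eq_inorder_Nil)

text \<open>A left child in \<open>S\<close> is rotated to the root; once there is none, only the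
  right subtree remains. The opposite rotation undoes each step at the same price, which gives the
  way back from the vine.\<close>

lemma straighten:
  "reach (straighten_cost S t) t (vine (tops S t) (rest S t)) \<and>
   reach (straighten_cost S t) (vine (tops S t) (rest S t)) t"
proof (induction "straighten_cost S t" arbitrary: t rule: less_induct)
  case less
  show ?case
  proof (cases t)
    case Leaf
    then show ?thesis by (simp add: reach_refl)
  next
    case t: (Node l a r)
    show ?thesis
    proof (cases "a \<in> S")
      case False
      then show ?thesis using t by (simp add: reach_refl)
    next
      case aS: True
      show ?thesis
      proof (cases "\<exists>ll b lr. l = Node ll b lr \<and> b \<in> S")
        case True
        then obtain ll b lr where l: "l = Node ll b lr" and bS: "b \<in> S" by blast
        define u where "u = Node ll b (Node lr a r)"
        have cost: "straighten_cost S t = 2 + straighten_cost S u"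
          using t l aS bS by (simp add: u_def)
        have same: "tops S u = tops S t" "rest S u = rest S t"
          using t l aS bS by (simp_all add: u_def)
        have tu: "reach 2 t u" using reach_rotation[of t False] t l by (simp add: u_def)
        have ut: "reach 2 u t" using reach_rotation[of u True] t l by (simp add: u_def)
        from less(1)[of u] cost same
        have "reach (straighten_cost S u) u (vine (tops S t) (rest S t))"
          "reach (straighten_cost S u) (vine (tops S t) (rest S t)) u" by auto
        then show ?thesis
          using reach_trans[OF tu] reach_trans[OF _ ut] cost by (metis add.commute)
      next
        case False
        then have "tops S l = []" "rest S l = l" by (cases l; auto)+
        then have v: "vine (tops S t) (rest S t) = Node l a (vine (tops S r) (rest S r))"
          and cost: "straighten_cost S t = straighten_cost S r + 2"
          using t aS by simp_all
        show ?thesis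
        proof (cases "r = Leaf")
          case True
          then show ?thesis using v t by (simp add: reach_refl)
        next
          case False
          then show ?thesis
            using less(1)[of r] cost v t reach_right vine_eq_Leaf by (metis less_add_same_cancel1 pos2)
        qed
      qed
    qed
  qed
qed

text \<open>The vine depends only on \<open>tops\<close> and \<open>rest\<close>, so it is a
  midpoint between any two shapes of the same top part.\<close>

lemma restructure:
  assumes "tops S t' = tops S t" "rest S t' = rest S t"
  shows "reach (8 * length (tops S t)) t t'"
proof -
  have "reach (straighten_cost S t + straighten_cost S t') t t'"
    using straighten[of S t] straighten[of S t'] assms reach_trans by metis
  then show ?thesis
    using straighten_cost_le[of S t] straighten_cost_le[of S t'] assms
    by (elim reach_mono) simp
qed

section \<open>Pointer walks and the cost of one search\<close>

lemma subt_butlast_not_Leaf: "subt t (p @ q) \<noteq> Leaf \<Longrightarrow> subt t p \<noteq> Leaf"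
proof (induction t p rule: subt.induct)
  case (2 d p)
  then show ?case by (cases q) auto
next
  case (1 t)
  then show ?case by (cases q) auto
qed (auto split: if_splits)

lemma walk_down: "subt t p \<noteq> Leaf \<Longrightarrow> (bst_step ^^ length p) (t, []) (t, p)"
proof (induction p rule: rev_induct)
  case Nil
  then show ?case by simp
next
  case (snoc d p)
  then have "(bst_step ^^ length p) (t, []) (t, p)" using subt_butlast_not_Leaf by blast
  then show ?case using bst_step.down[OF snoc.prems] by auto
qed

lemma walk_up: "(bst_step ^^ length p) (t, p) (t, [])"
proof (induction p rule: rev_induct)
  case Nil
  then show ?case by simp
next
  case (snoc d p)
  have "bst_step (t, p @ [d]) (t, p)" using bst_step.up[of "p @ [d]" t] by simp
  then show ?case using snoc relpowp_Suc_I2 by fastforce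
qed

lemma tops_path:
  assumes "x \<in> snd ` set (tops S t)"
  shows "\<exists>p. key_of (subt t p) = Some x \<and> length p < length (tops S t)"
  using assms
proof (induction t)
  case Leaf
  then show ?case by simp
next
  case (Node l a r)
  have aS: "a \<in> S" using Node.prems by (auto split: if_splits)
  consider "x = a" | "x \<in> snd ` set (tops S l)" | "x \<in> snd ` set (tops S r)"
    using Node.prems by (auto split: if_splits)
  then show ?case
  proof cases
    case 1
    then show ?thesis using aS by (intro exI[of _ "[]"]) auto
  next
    case 2
    then obtain p where "key_of (subt l p) = Some x" "length p < length (tops S l)"
      using Node.IH by blast
    then show ?thesis using aS by (intro exI[of _ "False # p"]) auto
  next
    case 3
    then obtain p where "key_of (subt r p) = Some x" "length p < length (tops S r)"
      using Node.IH by blast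
    then show ?thesis using aS by (intro exI[of _ "True # p"]) auto
  qed
qed

lemma bst_search_intro:
  assumes "(bst_step ^^ i) (t, []) s" "(bst_step ^^ j) s (t', [])"
    "key_of (subt (fst s) (snd s)) = Some x" "t \<noteq> Leaf"
  shows "bst_search t x t' (i + j)"
proof -
  obtain f where f: "f 0 = (t, [])" "f i = s" "\<And>m. m < i \<Longrightarrow> bst_step (f m) (f (Suc m))"
    using assms(1) by (auto simp: relpowp_fun_conv)
  obtain g where g: "g 0 = s" "g j = (t', [])" "\<And>m. m < j \<Longrightarrow> bst_step (g m) (g (Suc m))"
    using assms(2) by (auto simp: relpowp_fun_conv)
  define h where "h m = (if m \<le> i then f m else g (m - i))" for m
  let ?ss = "map h [0..<Suc (i + j)]"
  have step: "bst_step (h m) (h (Suc m))" if "m < i + j" for m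
  proof (cases "m < i")
    case True
    then show ?thesis using f by (simp add: h_def)
  next
    case False
    then have "h m = g (m - i)" "h (Suc m) = g (Suc (m - i))"
      using f g by (auto simp: h_def Suc_diff_le)
    then show ?thesis using g(3)[of "m - i"] False that by simp
  qed
  have "hd ?ss = (t, [])" using f(1) by (simp add: hd_map h_def del: upt_Suc)
  moreover have "fst (last ?ss) = t'"
    using f(2) g(1,2) by (cases j) (auto simp: h_def)
  moreover have "\<forall>m<i + j. bst_step (?ss ! m) (?ss ! Suc m)"
    using step by (simp del: upt_Suc)
  moreover have "s \<in> set ?ss" using f(2) by (force simp: h_def image_iff)
  moreover have "length ?ss = Suc (i + j)" by simp
  ultimately show ?thesis unfolding bst_search_def using assms(3,4) by blast
qed

text \<open>The restructuring may miss \<open>x\<close>, so a walk to \<open>x\<close> and back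
  comes first. Its two ways account for 2 of the 10 actions per top key.\<close>

lemma search_restructure:
  assumes "tops S t' = tops S t" "rest S t' = rest S t" "x \<in> snd ` set (tops S t)"
  shows "\<exists>k\<le>10 * length (tops S t). bst_search t x t' k"
proof -
  obtain p where p: "key_of (subt t p) = Some x" "length p < length (tops S t)"
    using tops_path[OF assms(3)] by blast
  have "subt t p \<noteq> Leaf" using p(1) by auto
  note down = walk_down[OF this]
  have "t \<noteq> Leaf" using assms(3) by auto
  obtain k where k: "k \<le> 8 * length (tops S t)" "(bst_step ^^ k) (t, []) (t', [])"
    using restructure[OF assms(1,2)] by (auto simp: reach_def)
  have "(bst_step ^^ (length p + k)) (t, p) (t', [])"
    using walk_up k(2) by (rule relpowp_trans)
  then have "bst_search t x t' (length p + (length p + k))"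
    using bst_search_intro[OF down] p(1) \<open>t \<noteq> Leaf\<close> by simp
  moreover have "length p + (length p + k) \<le> 10 * length (tops S t)" using k(1) p(2) by simp
  ultimately show ?thesis by blast
qed

lemma length_tops_le: "bst t \<Longrightarrow> length (tops S t) \<le> card (S \<inter> set_tree t)"
proof (induction t)
  case Leaf
  then show ?case by simp
next
  case (Node l a r)
  show ?case
  proof (cases "a \<in> S")
    case True
    have "S \<inter> set_tree (Node l a r) = insert a ((S \<inter> set_tree l) \<union> (S \<inter> set_tree r))"
      using True by auto
    moreover have "(S \<inter> set_tree l) \<inter> (S \<inter> set_tree r) = {}"
      "a \<notin> (S \<inter> set_tree l) \<union> (S \<inter> set_tree r)"
      using Node.prems by fastforce+
    ultimately have "card (S \<inter> set_tree (Node l a r)) =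
        Suc (card (S \<inter> set_tree l) + card (S \<inter> set_tree r))"
      by (simp add: card_Un_disjoint)
    then show ?thesis using Node True by simp
  qed simp
qed

section \<open>Heap-ordered search trees\<close>

fun heap_on :: "('a \<Rightarrow> nat) \<Rightarrow> 'a tree \<Rightarrow> bool" where
  "heap_on f Leaf = True"
| "heap_on f (Node l a r) \<longleftrightarrow>
     (\<forall>x\<in>set_tree l \<union> set_tree r. f a \<le> f x) \<and> heap_on f l \<and> heap_on f r"

definition hangs :: "('a tree \<times> 'a) list \<Rightarrow> 'a tree \<Rightarrow> 'a tree set" where
  "hangs xs h = insert h (fst ` set xs)"

lemma hangs_simps [simp]:
  "hangs [] h = {h}"
  "hangs ((g, q) # xs) h = insert g (hangs xs h)"
  "hangs (ys @ (g, q) # zs) h = hangs ys g \<union> hangs zs h"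
  by (auto simp: hangs_def)

lemma set_vine: "set_tree (vine xs h) = snd ` set xs \<union> \<Union> (set_tree ` hangs xs h)"
  by (induction xs) (auto simp: image_iff, force+)

lemma set_tops_subset: "snd ` set (tops S t) \<subseteq> S"
  by (induction t) auto

lemma heap_on_hangs:
  assumes "heap_on f t" "g \<in> hangs (tops S t) (rest S t)"
  shows "heap_on f g"
  using assms by (induction t) (auto split: if_splits)

lemma heap_on_cong: "(\<And>x. x \<in> set_tree t \<Longrightarrow> f x = f' x) \<Longrightarrow> heap_on f t = heap_on f' t"
  by (induction t) auto

text \<open>In a heap all ancestors of a key of minimal priority are minimal too. So the keys due at
  the least time \<open>m\<close> form a top tree, and cutting along \<open>S\<close> leaves none of
  them behind.\<close>

lemma hangs_minimal:
  assumes "heap_on f t" "\<And>k. k \<in> set_tree t \<Longrightarrow> m \<le> f k"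
    "\<And>k. k \<in> set_tree t \<Longrightarrow> k \<in> S \<longleftrightarrow> f k = m" "g \<in> hangs (tops S t) (rest S t)"
  shows "set_tree g \<inter> S = {}"
  using assms
proof (induction t)
  case Leaf
  then show ?case by simp
next
  case (Node l a r)
  show ?case
  proof (cases "a \<in> S")
    case True
    then have "g \<in> hangs (tops S l) (rest S l) \<or> g \<in> hangs (tops S r) (rest S r)"
      using Node.prems(4) by auto
    then show ?thesis using Node by auto
  next
    case False
    then have g: "g = Node l a r" using Node.prems(4) by simp
    have "m < f a" using False Node.prems(2,3)[of a] by fastforce
    then have "m < f k" if "k \<in> set_tree (Node l a r)" for k
      using that Node.prems(1) by (auto intro: less_le_trans)
    then show ?thesis using g Node.prems(3) by fastforce
  qed
qed

section \<open>Rebuilding the top of a heap under new priorities\<close>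

fun first_hang :: "('a tree \<times> 'a) list \<Rightarrow> 'a tree \<Rightarrow> 'a tree" where
  "first_hang [] h = h"
| "first_hang ((g, q) # xs) h = g"

text \<open>In every shape of the top part, the parent of a hanging subtree is one of the top keys
  next to it in key order. Comparing each top key with the hanging subtrees on its two sides is thus
  a heap condition that does not mention the shape.\<close>

fun adjacent_heap :: "('a \<Rightarrow> nat) \<Rightarrow> ('a tree \<times> 'a) list \<Rightarrow> 'a tree \<Rightarrow> bool" where
  "adjacent_heap f [] h = True"
| "adjacent_heap f ((g, q) # xs) h \<longleftrightarrow>
     (\<forall>z\<in>set_tree g \<union> set_tree (first_hang xs h). f q \<le> f z) \<and> adjacent_heap f xs h"

lemma first_hang_append [simp]: "first_hang (ys @ (g, q) # zs) h = first_hang ys g"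
  by (cases "(ys, h)" rule: first_hang.cases) auto

lemma adjacent_heap_append:
  "adjacent_heap f (ys @ (g, q) # zs) h \<longleftrightarrow>
     adjacent_heap f ys g \<and> adjacent_heap f ((g, q) # zs) h"
  by (induction ys) auto

lemma adjacent_heap_bound:
  assumes "adjacent_heap f xs h" "xs \<noteq> []" "\<And>q. q \<in> snd ` set xs \<Longrightarrow> m \<le> f q"
    "z \<in> set_tree (vine xs h)"
  shows "m \<le> f z"
  using assms
proof (induction xs)
  case Nil
  then show ?case by simp
next
  case (Cons p xs)
  obtain g q where p: "p = (g, q)" by force
  have "m \<le> f q" using Cons.prems(3) p by simp
  show ?case
  proof (cases "xs = []")
    case True
    then show ?thesis using Cons.prems(1,4) p \<open>m \<le> f q\<close> by (auto intro: le_trans)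
  next
    case False
    then have "m \<le> f z" if "z \<in> set_tree (vine xs h)"
      using Cons.IH Cons.prems(1,3) p that by auto
    then show ?thesis using Cons.prems(1,4) p \<open>m \<le> f q\<close> by (auto intro: le_trans)
  qed
qed

lemma tops_disjoint:
  assumes "set_tree g \<inter> S = {}"
  shows "tops S g = []" "rest S g = g"
  using assms by (cases g; auto)+

text \<open>Cartesian tree construction: a top key of least priority becomes the root and splits the
  list. The hanging subtree just before it becomes the rightmost one of the left part.\<close>

lemma build_heap:
  assumes "snd ` set xs \<subseteq> S" "\<And>g. g \<in> hangs xs h \<Longrightarrow> set_tree g \<inter> S = {} \<and> heap_on f g"
    "adjacent_heap f xs h"
  shows "\<exists>t. tops S t = xs \<and> rest S t = h \<and> heap_on f t"
  using assms
proof (induction "length xs" arbitrary: xs h rule: less_induct)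
  case less
  show ?case
  proof (cases "xs = []")
    case True
    then show ?thesis using less.prems tops_disjoint by (intro exI[of _ h]) auto
  next
    case False
    obtain p where p: "p \<in> set xs" "\<And>y. y \<in> set xs \<Longrightarrow> f (snd p) \<le> f (snd y)"
      using ex_has_least_nat[of "\<lambda>y. y \<in> set xs" _ "\<lambda>y. f (snd y)"] False
      by (metis hd_in_set)
    obtain g q where gq: "p = (g, q)" by force
    obtain ys zs where xs: "xs = ys @ (g, q) # zs" using p(1) gq by (metis split_list)
    note adj = less.prems(3)[unfolded xs adjacent_heap_append]
    have "\<exists>l. tops S l = ys \<and> rest S l = g \<and> heap_on f l"
      using less.prems adj by (intro less.hyps) (auto simp: xs)
    then obtain l where l: "tops S l = ys" "rest S l = g" "heap_on f l" by blast
    have "\<exists>r. tops S r = zs \<and> rest S r = h \<and> heap_on f r"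
      using less.prems adj by (intro less.hyps) (auto simp: xs)
    then obtain r where r: "tops S r = zs" "rest S r = h" "heap_on f r" by blast
    have qS: "q \<in> S" using less.prems(1) xs by auto
    let ?t = "Node l q r"
    have t: "tops S ?t = xs" "rest S ?t = h" using l r qS xs by auto
    have "set_tree ?t = set_tree (vine xs h)"
      using inorder_vine_tops[of S ?t] t by (metis set_inorder)
    then have "f q \<le> f z" if "z \<in> set_tree ?t" for z
      using adjacent_heap_bound[OF less.prems(3) False, of "f q" z] p(2) gq that by fastforce
    then show ?thesis using t l r by (intro exI[of _ ?t]) auto
  qed
qed

text \<open>The fourth assumption is shaped for the induction along the vine: removing the first key
  leaves keys of \<open>S\<close> that are no longer listed but lie to the left of everything that
  remains.\<close>

lemma adjacent_heap_vine:
  fixes S :: "'a::linorder set"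
  assumes "bst (vine xs h)" "snd ` set xs \<subseteq> S"
    "\<And>g. g \<in> hangs xs h \<Longrightarrow> set_tree g \<inter> S = {}"
    "\<And>c. c \<in> S \<Longrightarrow> c \<in> snd ` set xs \<or> (\<forall>z\<in>set_tree (vine xs h). c < z)"
    "\<And>q z. q \<in> S \<Longrightarrow> z \<in> set_tree (vine xs h) \<Longrightarrow> z \<notin> S \<Longrightarrow>
       (\<And>c. c \<in> S \<Longrightarrow> \<not> (q < c \<and> c < z) \<and> \<not> (z < c \<and> c < q)) \<Longrightarrow> f q \<le> f z"
  shows "adjacent_heap f xs h"
  using assms
proof (induction xs)
  case Nil
  then show ?case by simp
next
  case (Cons p xs)
  obtain g q where p: "p = (g, q)" by force
  have bst: "bst (vine xs h)" "\<And>z. z \<in> set_tree g \<Longrightarrow> z < q"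
    "\<And>z. z \<in> set_tree (vine xs h) \<Longrightarrow> q < z"
    using Cons.prems(1) p by auto
  have qS: "q \<in> S" using Cons.prems(2) p by simp
  have S: "c = q \<or> c \<in> snd ` set xs \<or> (\<forall>z\<in>set_tree (vine (p # xs) h). c < z)" if "c \<in> S" for c
    using Cons.prems(4)[OF that] p by auto
  have first: "set_tree (first_hang xs h) \<subseteq> set_tree (vine xs h)"
    by (cases "(xs, h)" rule: first_hang.cases) auto
  have before: "z < c" if "z \<in> set_tree (first_hang xs h)" "c \<in> snd ` set xs" for z c
  proof (cases "(xs, h)" rule: first_hang.cases)
    case (2 g' q' ys h')
    then have "z < q'" "c = q' \<or> c \<in> set_tree (vine ys h)" "\<forall>y\<in>set_tree (vine ys h). q' < y"
      using bst(1) that by (auto simp: set_vine)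
    then show ?thesis by auto
  qed (use that in auto)
  have firstS: "first_hang xs h \<in> hangs xs h"
    by (cases "(xs, h)" rule: first_hang.cases) auto
  have "f q \<le> f z" if z: "z \<in> set_tree g" for z
  proof (rule Cons.prems(5)[OF qS])
    show "z \<in> set_tree (vine (p # xs) h)" using z p by simp
    show "z \<notin> S" using Cons.prems(3)[of g] p z by auto
    show "\<not> (q < c \<and> c < z) \<and> \<not> (z < c \<and> c < q)" if "c \<in> S" for c
    proof -
      have "z < q" using bst(2) z by blast
      moreover have "c = q \<or> q < c \<or> c < z"
        using S[OF that] bst(3) z p set_vine[of xs h] by auto
      ultimately show ?thesis by auto
    qed
  qed
  moreover have "f q \<le> f z" if z: "z \<in> set_tree (first_hang xs h)" for z
  proof (rule Cons.prems(5)[OF qS])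
    show "z \<in> set_tree (vine (p # xs) h)" using z p first by auto
    show "z \<notin> S" using Cons.prems(3)[of "first_hang xs h"] firstS p z by auto
    show "\<not> (q < c \<and> c < z) \<and> \<not> (z < c \<and> c < q)" if "c \<in> S" for c
    proof -
      have zv: "z \<in> set_tree (vine xs h)" using z first by blast
      then have "q < z" using bst(3) by blast
      moreover have "c = q \<or> z < c \<or> c < q"
        using S[OF that] before[OF z] p by auto
      ultimately show ?thesis by auto
    qed
  qed
  moreover have "adjacent_heap f xs h"
  proof (rule Cons.IH[OF bst(1)])
    show "snd ` set xs \<subseteq> S" using Cons.prems(2) by auto
    show "set_tree g' \<inter> S = {}" if "g' \<in> hangs xs h" for g'
      using Cons.prems(3)[of g'] that p by auto
    show "c \<in> snd ` set xs \<or> (\<forall>z\<in>set_tree (vine xs h). c < z)" if "c \<in> S" for c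
      using S[OF that] bst(3) p by auto
    show "f q' \<le> f z" if "q' \<in> S" "z \<in> set_tree (vine xs h)" "z \<notin> S"
      "\<And>c. c \<in> S \<Longrightarrow> \<not> (q' < c \<and> c < z) \<and> \<not> (z < c \<and> c < q')" for q' z
      using Cons.prems(5)[of q' z] that p by auto
  qed
  ultimately show ?case using p by auto
qed

section \<open>Executing arborally satisfied point sets\<close>

text \<open>The endpoints are unordered so that the same formulas serve when time runs backwards, as
  in \<open>flip\<close>.\<close>

definition between :: "nat \<Rightarrow> nat \<Rightarrow> nat \<Rightarrow> bool" where
  "between a c b \<longleftrightarrow> min a b \<le> c \<and> c \<le> max a b"

text \<open>Coordinates are (key, time). Rectangles are closed, so the third point may lie on a side
  or at another corner.\<close>

definition satisfied :: "(nat \<times> nat) set \<Rightarrow> bool" where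
  "satisfied P \<longleftrightarrow> (\<forall>a s b t. (a, s) \<in> P \<longrightarrow> (b, t) \<in> P \<longrightarrow> a \<noteq> b \<longrightarrow> s \<noteq> t \<longrightarrow>
     (\<exists>c u. (c, u) \<in> P \<and> (c, u) \<noteq> (a, s) \<and> (c, u) \<noteq> (b, t) \<and> between a c b \<and> between s u t))"

lemma between_refl [simp]: "between a a b" "between b a a" "between a b b"
  by (auto simp: between_def)

lemma between_iff: "between a c b \<longleftrightarrow> a \<le> c \<and> c \<le> b \<or> b \<le> c \<and> c \<le> a"
  by (auto simp: between_def)

lemma between_commute: "between a c b \<longleftrightarrow> between b c a"
  by (auto simp: between_def)

lemma satisfiedD:
  assumes "satisfied P" "(a, s) \<in> P" "(b, t) \<in> P" "a \<noteq> b" "s \<noteq> t"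
  obtains c u where "(c, u) \<in> P" "(c, u) \<noteq> (a, s)" "(c, u) \<noteq> (b, t)"
    "between a c b" "between s u t"
  using assms unfolding satisfied_def by metis

text \<open>A strip in one coordinate is convex, so the third point stays inside. Partition sorts
  need this: keys and times change places, and rows that are not keys are cut away.\<close>

lemma satisfied_transpose_restrict:
  assumes "satisfied P"
  shows "satisfied {(k, i). (i, k) \<in> P \<and> lo \<le> k \<and> k \<le> hi}"
  unfolding satisfied_def
proof (intro allI impI)
  fix a s b t
  let ?P = "{(k, i). (i, k) \<in> P \<and> lo \<le> k \<and> k \<le> hi}"
  assume as: "(a, s) \<in> ?P" and bt: "(b, t) \<in> ?P" and "a \<noteq> b" "s \<noteq> t"
  then obtain c u where "(c, u) \<in> P" "(c, u) \<noteq> (s, a)" "(c, u) \<noteq> (t, b)"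
    "between s c t" "between a u b"
    using satisfiedD[OF assms, of s a t b] by auto
  moreover from this as bt have "(u, c) \<in> ?P" by (auto simp: between_def)
  ultimately show "\<exists>c u. (c, u) \<in> ?P \<and> (c, u) \<noteq> (a, s) \<and> (c, u) \<noteq> (b, t) \<and>
      between a c b \<and> between s u t" by blast
qed

text \<open>The rectangle with corners (\<open>q\<close>, \<open>t\<close>) and (\<open>c\<close>,
  \<open>u\<close>) is shrunk. A third point in column \<open>q\<close> is the access sought; any
  other lies later than \<open>t\<close>, because row \<open>t\<close> is clear, and replaces
  (\<open>c\<close>, \<open>u\<close>).\<close>

lemma satisfied_next_access:
  assumes "satisfied P" "(q, t) \<in> P" "(c, u) \<in> P" "t < u" "q \<noteq> c"
    "\<And>d. (d, t) \<in> P \<Longrightarrow> d \<noteq> q \<Longrightarrow> \<not> between q d c"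
  shows "\<exists>v. t < v \<and> v \<le> u \<and> (q, v) \<in> P"
  using assms
\<comment> \<open>The two truncated differences add up to the distance of \<open>c\<close> and
  \<open>q\<close>.\<close>
proof (induction "u + (c - q) + (q - c)" arbitrary: c u rule: less_induct)
  case less
  obtain d v where d: "(d, v) \<in> P" "(d, v) \<noteq> (q, t)" "(d, v) \<noteq> (c, u)"
    "between q d c" "between t v u"
    using satisfiedD[OF less.prems(1-3)] less.prems(4,5) by blast
  have v: "t \<le> v" "v \<le> u" using d(5) less.prems(4) by (auto simp: between_def)
  show ?case
  proof (cases "d = q")
    case True
    then show ?thesis using d v by (intro exI[of _ v]) auto
  next
    case False
    then have "t < v" using less.prems(6)[of d] d(1,4) v by (metis le_neq_implies_less)
    have "\<exists>w. t < w \<and> w \<le> v \<and> (q, w) \<in> P"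
    proof (rule less.hyps)
      show "v + (d - q) + (q - d) < u + (c - q) + (q - c)"
        using d(3,4) v by (auto simp: between_iff)
      show "\<not> between q e d" if "(e, t) \<in> P" "e \<noteq> q" for e
        using less.prems(6)[OF that] d(4)
        by (auto simp: between_iff)
    qed (use d(1) less.prems \<open>t < v\<close> False in auto)
    then show ?thesis using v(2) by (meson le_trans)
  qed
qed

text \<open>\<open>N\<close> stands for "never"; the disjunct on \<open>N\<close> guarantees that
  \<open>LEAST\<close> has a candidate.\<close>

definition next_access :: "(nat \<times> nat) set \<Rightarrow> nat \<Rightarrow> nat \<Rightarrow> nat \<Rightarrow> nat" where
  "next_access P N t k = (LEAST u. t \<le> u \<and> ((k, u) \<in> P \<or> N \<le> u))"

lemma next_access:
  assumes "t \<le> N"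
  shows "t \<le> next_access P N t k" "next_access P N t k \<le> N"
    "(k, next_access P N t k) \<in> P \<or> next_access P N t k = N"
proof -
  let ?Q = "\<lambda>u. t \<le> u \<and> ((k, u) \<in> P \<or> N \<le> u)"
  have "?Q N" using assms by simp
  then have "?Q (next_access P N t k)" "next_access P N t k \<le> N"
    unfolding next_access_def by (rule LeastI, rule Least_le)
  then show "t \<le> next_access P N t k" "next_access P N t k \<le> N"
    "(k, next_access P N t k) \<in> P \<or> next_access P N t k = N" by auto
qed

lemma next_access_le: "t \<le> u \<Longrightarrow> (k, u) \<in> P \<Longrightarrow> next_access P N t k \<le> u"
  unfolding next_access_def by (rule Least_le) simp

lemma next_access_now:
  assumes "t < N"
  shows "next_access P N t k = t \<longleftrightarrow> (k, t) \<in> P"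
proof
  assume "next_access P N t k = t"
  then show "(k, t) \<in> P" using next_access(3)[of t N k P] assms by auto
next
  assume "(k, t) \<in> P"
  then show "next_access P N t k = t"
    using next_access(1)[of t N P k] next_access_le[of t t k P N] assms by simp
qed

lemma next_access_Suc:
  assumes "(k, t) \<notin> P" "t < N"
  shows "next_access P N (Suc t) k = next_access P N t k"
proof -
  have "(Suc t \<le> u \<and> ((k, u) \<in> P \<or> N \<le> u)) \<longleftrightarrow> (t \<le> u \<and> ((k, u) \<in> P \<or> N \<le> u))" for u
    using assms by (metis Suc_leD Suc_leI le_neq_implies_less not_le)
  then show ?thesis by (simp add: next_access_def)
qed

text \<open>The invariant is that the current tree is a treap whose priorities are the times of next
  access. The keys accessed now have minimal priority, so they form a top tree; satisfiedness
  makes the new priorities compatible with the hanging subtrees.\<close>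

lemma serve_suffix:
  assumes sat: "satisfied P" and fin: "finite P"
    and xs: "\<And>i. i < length xs \<Longrightarrow> (xs ! i, i) \<in> P \<and> xs ! i \<in> K"
    and i: "i \<le> length xs"
    and t: "bst t" "set_tree t = K" "heap_on (next_access P (length xs) i) t"
    and K: "\<And>k u. (k, u) \<in> P \<Longrightarrow> k \<in> K"
  shows "\<exists>c\<le>10 * (\<Sum>j=i..<length xs. card {k. (k, j) \<in> P}). bst_serves t (drop i xs) c"
  using i t
proof (induction i arbitrary: t rule: inc_induct)
  case base
  then show ?case using bst_serves.Nil by auto
next
  case (step i)
  let ?N = "length xs"
  let ?f = "next_access P ?N i" and ?f' = "next_access P ?N (Suc i)"
  define S where "S = {k. (k, i) \<in> P}"
  have iN: "i < ?N" using step.hyps by simp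
  have S_iff: "k \<in> S \<longleftrightarrow> ?f k = i" for k using next_access_now[OF iN] by (simp add: S_def)
  have disj: "set_tree g \<inter> S = {}" if "g \<in> hangs (tops S t) (rest S t)" for g
    using hangs_minimal[OF step.prems(3), of i S g] that S_iff next_access(1)[of i ?N P] iN by simp
  have heap: "heap_on ?f' g" if g: "g \<in> hangs (tops S t) (rest S t)" for g
  proof -
    have "heap_on ?f g" using heap_on_hangs[OF step.prems(3) g] .
    moreover have "?f k = ?f' k" if "k \<in> set_tree g" for k
    proof -
      have "(k, i) \<notin> P" using disj[OF g] that by (auto simp: S_def)
      then show ?thesis using next_access_Suc[of k i P ?N] iN by simp
    qed
    ultimately show ?thesis using heap_on_cong[of g ?f ?f'] by blast
  qed
  have vine: "inorder (vine (tops S t) (rest S t)) = inorder t" by (rule inorder_vine_tops)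
  then have set_vine_t: "set_tree (vine (tops S t) (rest S t)) = K"
    using step.prems(2) by (metis set_inorder)
  have "S \<subseteq> K" using K by (auto simp: S_def)
  then have S_tops: "S \<subseteq> snd ` set (tops S t)"
    using disj set_vine_t set_vine[of "tops S t" "rest S t"] by blast
  have adj: "adjacent_heap ?f' (tops S t) (rest S t)"
  proof (rule adjacent_heap_vine[where S = S])
    show "bst (vine (tops S t) (rest S t))"
      using step.prems(1) vine by (simp add: bst_iff_sorted_wrt_less)
    fix q z
    assume q: "q \<in> S" and z: "z \<notin> S"
      and gap: "\<And>c. c \<in> S \<Longrightarrow> \<not> (q < c \<and> c < z) \<and> \<not> (z < c \<and> c < q)"
    have le: "Suc i \<le> ?N" using iN by simp
    consider "?f' z = ?N" | "(z, ?f' z) \<in> P" using next_access(3)[OF le] by blast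
    then show "?f' q \<le> ?f' z"
    proof cases
      case 1
      then show ?thesis using next_access(2)[OF le] by simp
    next
      case 2
      \<comment> \<open>No key of \<open>S\<close> separates \<open>q\<close> from \<open>z\<close>,
        so row \<open>i\<close> is clear between them and satisfaction forces an access to
        \<open>q\<close> no later than the next one to \<open>z\<close>.\<close>
      have "\<not> between q d z" if "(d, i) \<in> P" "d \<noteq> q" for d
      proof -
        have "d \<in> S" using that by (simp add: S_def)
        then have "d \<noteq> z" "\<not> (q < d \<and> d < z)" "\<not> (z < d \<and> d < q)" using z gap by auto
        then show ?thesis using that(2)
          by (auto simp: between_iff)
      qed
      then obtain v where "i < v" "v \<le> ?f' z" "(q, v) \<in> P"
        using satisfied_next_access[OF sat, of q i z "?f' z"] 2 q z next_access(1)[OF le, of P z]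
        by (auto simp: S_def)
      then show ?thesis using next_access_le[of "Suc i" v q P ?N] by simp
    qed
  next
    show "snd ` set (tops S t) \<subseteq> S" by (rule set_tops_subset)
    show "set_tree g \<inter> S = {}" if "g \<in> hangs (tops S t) (rest S t)" for g
      using disj[OF that] .
    show "c \<in> snd ` set (tops S t) \<or> (\<forall>z\<in>set_tree (vine (tops S t) (rest S t)). c < z)"
      if "c \<in> S" for c using S_tops that by blast
  qed
  \<comment> \<open>The top part is reshaped for the priorities after time \<open>i\<close>. Keys
    not accessed at \<open>i\<close> keep theirs, so the hanging subtrees can stay as they
    are.\<close>
  obtain t' where t': "tops S t' = tops S t" "rest S t' = rest S t" "heap_on ?f' t'"
    using build_heap[OF set_tops_subset _ adj] disj heap by blast
  have io: "inorder t' = inorder t" using inorder_vine_tops t'(1,2) by metis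
  have "xs ! i \<in> S" using xs[OF iN] by (simp add: S_def)
  then obtain k where k: "k \<le> 10 * length (tops S t)" "bst_search t (xs ! i) t' k"
    using search_restructure[OF t'(1,2)] S_tops by blast
  have "bst t'" "set_tree t' = K"
    using step.prems(1,2) io by (auto simp: bst_iff_sorted_wrt_less) (metis set_inorder)+
  then obtain c where c: "c \<le> 10 * (\<Sum>j=Suc i..<?N. card {k. (k, j) \<in> P})"
    "bst_serves t' (drop (Suc i) xs) c"
    using step.IH t'(3) by blast
  have "finite S" using finite_subset[of "S" "fst ` P"] fin by (force simp: S_def)
  then have "length (tops S t) \<le> card S"
    using length_tops_le[OF step.prems(1), of S] card_mono[of S "S \<inter> set_tree t"] by simp
  then have "k + c \<le> 10 * (\<Sum>j=i..<?N. card {k. (k, j) \<in> P})"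
    using k(1) c(1) iN by (simp add: sum.atLeast_Suc_lessThan S_def)
  moreover have "bst_serves t (drop i xs) (k + c)"
    using bst_serves.Cons[OF k(2) c(2)] iN by (simp add: Cons_nth_drop_Suc)
  ultimately show ?case by blast
qed

lemma sum_card_rows_le:
  fixes P :: "('a \<times> nat) set"
  assumes "finite P"
  shows "(\<Sum>j\<in>{0..<n}. card {k. (k, j) \<in> P}) \<le> card P"
proof -
  have fin: "finite {k. (k, j) \<in> P}" for j
    using finite_subset[of "{k. (k, j) \<in> P}" "fst ` P"] assms by force
  have "(\<Sum>j\<in>{0..<n}. card {k. (k, j) \<in> P}) = card (SIGMA j:{0..<n}. {k. (k, j) \<in> P})"
    using fin by simp
  also have "\<dots> = card (prod.swap ` (SIGMA j:{0..<n}. {k. (k, j) \<in> P}))"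
    by (simp add: card_image)
  also have "\<dots> \<le> card P" using assms by (intro card_mono) auto
  finally show ?thesis .
qed

lemma adjacent_heap_Leaf: "\<forall>p\<in>set xs. fst p = Leaf \<Longrightarrow> adjacent_heap f xs Leaf"
proof (induction xs)
  case (Cons p xs)
  then show ?case by (cases p; cases "(xs, Leaf :: 'a tree)" rule: first_hang.cases) auto
qed simp

text \<open>The case of \<open>build_heap\<close> in which every key is a top key and all hanging
  subtrees are leaves.\<close>

lemma treap_exists:
  assumes "finite K"
  shows "\<exists>t :: 'a::linorder tree. bst t \<and> set_tree t = K \<and> heap_on f t"
proof -
  let ?xs = "map (\<lambda>k. (Leaf, k)) (sorted_list_of_set K)"
  have "\<exists>t. tops K t = ?xs \<and> rest K t = Leaf \<and> heap_on f t"
    using assms by (intro build_heap adjacent_heap_Leaf) (auto simp: hangs_def)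
  then obtain t where t: "tops K t = ?xs" "rest K t = Leaf" "heap_on f t" by blast
  have "inorder (vine (map (\<lambda>k. (Leaf, k)) ks) Leaf) = ks" for ks :: "'a list"
    by (induction ks) auto
  then have io: "inorder t = sorted_list_of_set K" using inorder_vine_tops[of K t] t(1,2) by simp
  then have "bst t" by (simp add: bst_iff_sorted_wrt_less)
  moreover have "set_tree t = K" using io assms by (metis set_inorder set_sorted_list_of_set)
  ultimately show ?thesis using t(3) by blast
qed

lemma OPT_BST_le_satisfied:
  assumes sat: "satisfied P" and fin: "finite P" and keys: "fst ` P \<subseteq> set xs"
    and xs: "\<And>i. i < length xs \<Longrightarrow> (xs ! i, i) \<in> P"
  shows "OPT_BST xs \<le> 10 * card P"
proof -
  obtain t where t: "bst t" "set_tree t = set xs" "heap_on (next_access P (length xs) 0) t"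
    using treap_exists[of "set xs"] by blast
  have "\<exists>c\<le>10 * (\<Sum>j\<in>{0..<length xs}. card {k. (k, j) \<in> P}). bst_serves t (drop 0 xs) c"
    by (rule serve_suffix[OF sat fin _ _ t]) (use xs keys in force)+
  then obtain c where c: "c \<le> 10 * (\<Sum>j\<in>{0..<length xs}. card {k. (k, j) \<in> P})"
    "bst_serves t xs c" by auto
  have "OPT_BST xs \<le> c" unfolding OPT_BST_def by (rule Least_le) (use t c in blast)
  then show ?thesis using c(1) sum_card_rows_le[OF fin, of "length xs"] by linarith
qed

section \<open>The point set of a mergesort\<close>

fun ancestor :: "'a tree \<Rightarrow> 'a \<Rightarrow> 'a \<Rightarrow> bool" where
  "ancestor Leaf a b = False"
| "ancestor (Node l x r) a b \<longleftrightarrow>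
     x = a \<and> b \<in> set_tree l \<union> set_tree r \<or> ancestor l a b \<or> ancestor r a b"

lemma ancestor_in_set: "ancestor t a b \<Longrightarrow> a \<in> set_tree t \<and> b \<in> set_tree t"
  by (induction t) auto

lemma ancestor_neq: "bst t \<Longrightarrow> ancestor t a b \<Longrightarrow> a \<noteq> b"
  by (induction t) auto

lemma cut_top_subset: "cut_top S t \<subseteq> set_tree t \<inter> S"
  by (induction t) auto

lemma cut_top_ancestor_closed:
  assumes "bst t" "ancestor t a b" "b \<in> cut_top S t"
  shows "a \<in> S"
  using assms
proof (induction t)
  case Leaf
  then show ?case by simp
next
  case (Node l x r)
  have xS: "x \<in> S" using Node.prems(3) by (auto split: if_splits)
  have b: "b = x \<or> b \<in> cut_top S l \<or> b \<in> cut_top S r" using Node.prems(3) xS by simp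
  have lt: "\<And>y. y \<in> set_tree l \<Longrightarrow> y < x" "\<And>y. y \<in> set_tree r \<Longrightarrow> x < y"
    using Node.prems(1) by auto
  have sub: "cut_top S l \<subseteq> set_tree l" "cut_top S r \<subseteq> set_tree r"
    using cut_top_subset[of S l] cut_top_subset[of S r] by simp_all
  consider "x = a" | "ancestor l a b" | "ancestor r a b" using Node.prems(2) by auto
  then show ?case
  proof cases
    case 1
    then show ?thesis using xS by simp
  next
    case 2
    then have "b < x" using ancestor_in_set[of l a b] lt(1) by blast
    then have "b \<in> cut_top S l" using b sub(2) lt(2)[of b] by auto
    then show ?thesis using Node.IH(1) Node.prems(1) 2 by simp
  next
    case 3
    then have "x < b" using ancestor_in_set[of r a b] lt(2) by blast
    then have "b \<in> cut_top S r" using b sub(1) lt(1)[of b] by auto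
    then show ?thesis using Node.IH(2) Node.prems(1) 3 by simp
  qed
qed

text \<open>An ancestor outside \<open>S\<close> lies below the cut together with its descendants.
  As a merge keeps hanging subtrees, such pairs are inherited from an input tree.\<close>

lemma ancestor_hanging: "ancestor t a b \<Longrightarrow> a \<notin> S \<Longrightarrow> \<exists>s\<in>hanging S t. ancestor s a b"
  by (induction t) auto

lemma ancestor_subtree: "s \<in> subtrees t \<Longrightarrow> ancestor s a b \<Longrightarrow> ancestor t a b"
  by (induction t) auto

lemma lowest_common_ancestor:
  assumes "bst t" "a \<in> set_tree t" "b \<in> set_tree t" "a \<noteq> b"
  shows "ancestor t a b \<or> ancestor t b a \<or>
    (\<exists>c. ancestor t c a \<and> ancestor t c b \<and> (a < c \<and> c < b \<or> b < c \<and> c < a))"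
  using assms
proof (induction t)
  case Leaf
  then show ?case by simp
next
  case (Node l x r)
  consider "a = x \<or> b = x" | "a \<in> set_tree l" "b \<in> set_tree l" | "a \<in> set_tree r" "b \<in> set_tree r"
    | "a \<in> set_tree l" "b \<in> set_tree r" | "a \<in> set_tree r" "b \<in> set_tree l"
    using Node.prems(2,3) by auto
  then show ?case
  proof cases
    case 1
    then show ?thesis using Node.prems(2-4) by auto
  next
    case 2
    have "bst l" using Node.prems(1) by simp
    then show ?thesis using Node.IH(1) 2 Node.prems(4) by fastforce
  next
    case 3
    have "bst r" using Node.prems(1) by simp
    then show ?thesis using Node.IH(2) 3 Node.prems(4) by fastforce
  next
    case 4
    then have "a < x" "x < b" using Node.prems(1) by auto
    then show ?thesis using 4 by auto
  next
    case 5
    then have "b < x" "x < a" using Node.prems(1) by auto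
    then show ?thesis using 5 by auto
  qed
qed

lemma change_point:
  fixes i j :: nat
  assumes "i < j" "f i \<noteq> f j"
  shows "\<exists>k. i \<le> k \<and> k < j \<and> f k \<noteq> f (Suc k)"
proof (rule ccontr)
  assume *: "\<not> ?thesis"
  have "k \<le> j \<longrightarrow> f i = f k" if "i \<le> k" for k
    using that
  proof (induction k rule: dec_induct)
    case (step k)
    then show ?case using * by (auto dest: Suc_le_lessD less_imp_le)
  qed simp
  then show False using assms by auto
qed

text \<open>On the way from \<open>a\<close> to \<open>b\<close> the value of \<open>f\<close>
  changes between two neighbours in the list. Both are block boundaries, one of each kind.\<close>

lemma block_boundary_between:
  fixes xs :: "nat list"
  assumes sorted: "sorted_wrt (<) xs" and ab: "a \<in> set xs" "b \<in> set xs" "f a \<noteq> f b"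
  shows "\<exists>c\<in>block_bounds xs f. \<exists>d\<in>block_bounds xs f. f c \<noteq> f d \<and> between a c b \<and> between a d b"
proof -
  have main: "\<exists>c\<in>block_bounds xs f. \<exists>d\<in>block_bounds xs f.
      f c \<noteq> f d \<and> between (xs ! i) c (xs ! j) \<and> between (xs ! i) d (xs ! j)"
    if ij: "i < j" "j < length xs" "f (xs ! i) \<noteq> f (xs ! j)" for i j
  proof -
    obtain k where k: "i \<le> k" "k < j" "f (xs ! k) \<noteq> f (xs ! Suc k)"
      using change_point[of i j "\<lambda>k. f (xs ! k)"] ij by blast
    have mono: "xs ! m \<le> xs ! n" if "m \<le> n" "n < length xs" for m n
      using sorted_wrt_nth_less[OF sorted, of m n] that by (cases "m = n") auto
    have "between (xs ! i) (xs ! k) (xs ! j)" "between (xs ! i) (xs ! Suc k) (xs ! j)"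
      using mono[of i k] mono[of i "Suc k"] mono[of k j] mono[of "Suc k" j] k ij
      by (auto simp: between_def)
    moreover have "xs ! k \<in> block_bounds xs f"
      using k ij(2) unfolding block_bounds_def by (intro CollectI exI[of _ k]) auto
    moreover have "xs ! Suc k \<in> block_bounds xs f"
      using k ij(2) unfolding block_bounds_def by (intro CollectI exI[of _ "Suc k"]) auto
    ultimately show ?thesis using k(3) by blast
  qed
  obtain i j where ij: "i < length xs" "j < length xs" "xs ! i = a" "xs ! j = b"
    using ab(1,2) by (auto simp: in_set_conv_nth)
  consider "i < j" | "j < i" using ij ab(3) by (metis nat_neq_iff)
  then show ?thesis
  proof cases
    case 1
    then show ?thesis using main[OF 1] ij ab(3) by simp
  next
    case 2
    then show ?thesis using main[OF 2] ij ab(3) between_commute by metis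
  qed
qed

text \<open>\<open>guarded P R e\<close> says that, seen from the boundary row \<open>e\<close>, every point \<open>(b, t)\<close> is
  shielded from the column of each ancestor of \<open>b\<close>. The second half, which also excludes the
  corner \<open>(a, e)\<close>, is what satisfiedness needs when that corner belongs to the point set.\<close>

definition guarded :: "(nat \<times> nat) set \<Rightarrow> (nat \<Rightarrow> nat \<Rightarrow> bool) \<Rightarrow> nat \<Rightarrow> bool" where
  "guarded P R e \<longleftrightarrow> (\<forall>a b t. (b, t) \<in> P \<longrightarrow> R a b \<longrightarrow>
     (\<exists>c u. (c, u) \<in> P \<and> (c, u) \<noteq> (b, t) \<and> between a c b \<and> between e u t) \<and>
     (t \<noteq> e \<longrightarrow> (\<exists>c u. (c, u) \<in> P \<and> (c, u) \<noteq> (b, t) \<and> (c, u) \<noteq> (a, e) \<and>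
        between a c b \<and> between e u t)))"

lemma guardedD1:
  assumes "guarded P R e" "(b, t) \<in> P" "R a b"
  obtains c u where "(c, u) \<in> P" "(c, u) \<noteq> (b, t)" "between a c b" "between e u t"
  using assms unfolding guarded_def by blast

lemma guardedD2:
  assumes "guarded P R e" "(b, t) \<in> P" "R a b" "t \<noteq> e"
  obtains c u where "(c, u) \<in> P" "(c, u) \<noteq> (b, t)" "(c, u) \<noteq> (a, e)" "between a c b" "between e u t"
  using assms unfolding guarded_def by blast

text \<open>Here \<open>R1\<close>, \<open>R2\<close> and \<open>R\<close> are the ancestor relations of the two input trees and of the
  merged tree, \<open>S\<close> is the top tree, and the rows of the two parts lie between \<open>e\<close> and \<open>m\<close> and
  between \<open>m\<close> and \<open>f\<close>. The locale is symmetric under exchanging the parts.\<close>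

locale merge_rows =
  fixes P1 P2 :: "(nat \<times> nat) set" and K1 K2 S :: "nat set" and R1 R2 R :: "nat \<Rightarrow> nat \<Rightarrow> bool"
    and e m f :: nat
  assumes rows: "between e m f" "e \<noteq> m" "m \<noteq> f"
    and P1: "(b, t) \<in> P1 \<Longrightarrow> b \<in> K1 \<and> between e t m"
    and P2: "(b, t) \<in> P2 \<Longrightarrow> b \<in> K2 \<and> between m t f"
    and disjoint: "K1 \<inter> K2 = {}" and S: "S \<subseteq> K1 \<union> K2"
    and R1: "R1 a b \<Longrightarrow> a \<in> K1 \<and> b \<in> K1" and R2: "R2 a b \<Longrightarrow> a \<in> K2 \<and> b \<in> K2"
    and R_irrefl: "R a b \<Longrightarrow> a \<noteq> b"
    and top_closed: "R a b \<Longrightarrow> b \<in> S \<Longrightarrow> a \<in> S"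
    and hanging: "R a b \<Longrightarrow> a \<notin> S \<Longrightarrow> R1 a b \<or> R2 a b"
    and boundary: "a \<in> K1 \<Longrightarrow> b \<in> K2 \<Longrightarrow>
      \<exists>c\<in>S \<inter> K1. \<exists>d\<in>S \<inter> K2. between a c b \<and> between a d b"
    and gap1: "a \<in> S \<inter> K1 \<Longrightarrow> b \<in> K1 - S \<Longrightarrow> R1 a b \<or> (\<exists>c\<in>S. c \<noteq> a \<and> between a c b)"
    and gap2: "a \<in> S \<inter> K2 \<Longrightarrow> b \<in> K2 - S \<Longrightarrow> R2 a b \<or> (\<exists>c\<in>S. c \<noteq> a \<and> between a c b)"
    and sat1: "satisfied P1" and sat2: "satisfied P2"
    and guard1: "guarded P1 R1 e" "guarded P1 R1 m"
    and guard2: "guarded P2 R2 m" "guarded P2 R2 f"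
begin

definition points where "points = P1 \<union> P2 \<union> S \<times> {e, m, f}"

text \<open>Reversing time exchanges the two parts and the outer rows but keeps the point set.
  Claims about row \<open>f\<close> or the second part then follow from those about row
  \<open>e\<close> or the first.\<close>

lemma flip: "merge_rows P2 P1 K2 K1 S R2 R1 R f m e"
proof
  show "between f m e" using rows(1) by (simp add: between_commute)
  show "\<exists>c\<in>S \<inter> K2. \<exists>d\<in>S \<inter> K1. between a c b \<and> between a d b" if "a \<in> K2" "b \<in> K1" for a b
    using boundary[OF that(2,1)] between_commute by metis
  show "b \<in> K2 \<and> between f t m" if "(b, t) \<in> P2" for b t
    using P2[OF that] between_commute by blast
  show "b \<in> K1 \<and> between m t e" if "(b, t) \<in> P1" for b t
    using P1[OF that] between_commute by blast
  show "f \<noteq> m" "m \<noteq> e" using rows(2,3) by blast+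
  show "K2 \<inter> K1 = {}" "S \<subseteq> K2 \<union> K1" using disjoint S by blast+
  show "R2 a b \<or> R1 a b" if "R a b" "a \<notin> S" for a b using hanging[OF that] by blast
qed (fact R1 R2 R_irrefl top_closed gap1 gap2 sat1 sat2 guard1 guard2)+

lemma flip_points: "merge_rows.points P2 P1 S f m e = points"
  using merge_rows.points_def[OF flip] by (auto simp: points_def)

lemma top_gap:
  assumes "a \<in> S" "b \<in> K1" "b \<notin> S"
  shows "R1 a b \<or> (\<exists>c\<in>S. c \<noteq> a \<and> between a c b)"
proof (cases "a \<in> K1")
  case True
  then show ?thesis using gap1 assms by blast
next
  case False
  then have "a \<in> K2" using S assms(1) by blast
  then obtain c where "c \<in> S \<inter> K1" "between b c a" using boundary[OF assms(2)] by blast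
  moreover have "c \<noteq> a" using \<open>c \<in> S \<inter> K1\<close> False by blast
  ultimately show ?thesis using between_commute[of a c b] by blast
qed

lemma guarded_points: "guarded points R e"
  unfolding guarded_def
proof (intro allI impI)
  fix a b t
  assume bt: "(b, t) \<in> points" and R: "R a b"
  let ?G1 = "\<exists>c u. (c, u) \<in> points \<and> (c, u) \<noteq> (b, t) \<and> between a c b \<and> between e u t"
  let ?G2 = "\<exists>c u. (c, u) \<in> points \<and> (c, u) \<noteq> (b, t) \<and> (c, u) \<noteq> (a, e) \<and>
    between a c b \<and> between e u t"
  have ab: "a \<noteq> b" using R_irrefl[OF R] .
  have top: ?G1 if "a \<in> S" using that ab by (intro exI[of _ a] exI[of _ e]) (auto simp: points_def)
  show "?G1 \<and> (t \<noteq> e \<longrightarrow> ?G2)"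
  proof (cases "b \<in> S")
    case True
    \<comment> \<open>The witness is (\<open>b\<close>, \<open>e\<close>), in the column of
      \<open>b\<close>. Ancestors of top keys are top keys, so the corner (\<open>a\<close>,
      \<open>e\<close>) itself serves for the first half.\<close>
    have ?G2 if "t \<noteq> e"
      using that ab True by (intro exI[of _ b] exI[of _ e]) (auto simp: points_def)
    then show ?thesis using top top_closed[OF R True] by blast
  next
    case bS: False
    then consider "(b, t) \<in> P1" | "(b, t) \<in> P2" using bt by (auto simp: points_def)
    then show ?thesis
    proof cases
      case 1
      have b: "b \<in> K1" using P1[OF 1] by simp
      have R1G: "?G1 \<and> (t \<noteq> e \<longrightarrow> ?G2)" if "R1 a b"
        using guard1(1) 1 that unfolding guarded_def points_def by blast
      show ?thesis
      proof (cases "a \<in> S")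
        case True
        have ?G2 if "t \<noteq> e"
        proof -
          consider "R1 a b" | c where "c \<in> S" "c \<noteq> a" "between a c b"
            using top_gap[OF True b bS] by blast
          then show ?thesis
          proof cases
            case 1
            then show ?thesis using R1G that by blast
          next
            case 2
            then show ?thesis using that
              by (intro exI[of _ c] exI[of _ e]) (auto simp: points_def)
          qed
        qed
        then show ?thesis using top True by blast
      next
        case False
        then have "R1 a b" using hanging[OF R] R2 b disjoint by blast
        then show ?thesis using R1G by blast
      qed
    next
      case 2
      have b: "b \<in> K2" and t: "between m t f" using P2[OF 2] by simp_all
      \<comment> \<open>Row \<open>m\<close> separates this part from row \<open>e\<close>, so
        whatever shields \<open>b\<close> from row \<open>m\<close> also shields it from row
        \<open>e\<close>. The witnesses never lie in row \<open>e\<close>, hence avoid the corner,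
        and the first half of the guard at \<open>m\<close> is enough.\<close>
      have m: "between e m t" using t rows by (auto simp: between_iff)
      have ?G2
      proof (cases "a \<in> S")
        case True
        then show ?thesis using m ab rows
          by (intro exI[of _ a] exI[of _ m]) (auto simp: points_def)
      next
        case False
        then have "R2 a b" using hanging[OF R] R1 b disjoint by blast
        then obtain c u where cu: "(c, u) \<in> P2" "(c, u) \<noteq> (b, t)" "between a c b" "between m u t"
          using guardedD1[OF guard2(1) 2] by metis
        have "between e u t" "u \<noteq> e"
          using cu(4) t rows by (auto simp: between_iff)
        then show ?thesis using cu by (intro exI[of _ c] exI[of _ u]) (auto simp: points_def)
      qed
      then show ?thesis by blast
    qed
  qed
qed

text \<open>If \<open>b\<close> or another top key on the way to it lies in row \<open>s\<close>,
  that point is the witness. Otherwise \<open>a\<close> is an ancestor of \<open>b\<close> in the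
  first tree: rows \<open>e\<close> and \<open>m\<close> bound the first part, so its guards apply,
  and from row \<open>f\<close> the point (\<open>a\<close>, \<open>m\<close>) intervenes.\<close>

lemma top_first_satisfied:
  assumes a: "a \<in> S" and s: "s \<in> {e, m, f}" and bt: "(b, t) \<in> P1" and "a \<noteq> b" "s \<noteq> t"
  shows "\<exists>c u. (c, u) \<in> points \<and> (c, u) \<noteq> (a, s) \<and> (c, u) \<noteq> (b, t) \<and> between a c b \<and> between s u t"
proof -
  have b: "b \<in> K1" and t: "between e t m" using P1[OF bt] by simp_all
  have row: ?thesis if "c \<in> S" "c \<noteq> a" "between a c b" for c
    using that s \<open>s \<noteq> t\<close> by (intro exI[of _ c] exI[of _ s]) (auto simp: points_def)
  show ?thesis
  proof (cases "b \<in> S")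
    case True
    then show ?thesis using row[of b] \<open>a \<noteq> b\<close> by auto
  next
    case False
    then consider "R1 a b" | c where "c \<in> S" "c \<noteq> a" "between a c b"
      using top_gap[OF a b] by blast
    then show ?thesis
    proof cases
      case 1
      consider "s = e" | "s = m" | "s = f" using s by blast
      then show ?thesis
      proof cases
        case s: 1
        obtain c u where "(c, u) \<in> P1" "(c, u) \<noteq> (b, t)" "(c, u) \<noteq> (a, e)"
          "between a c b" "between e u t"
          using guardedD2[OF guard1(1) bt 1] \<open>s \<noteq> t\<close> s by metis
        then show ?thesis using s by (intro exI[of _ c] exI[of _ u]) (simp add: points_def)
      next
        case s: 2
        obtain c u where "(c, u) \<in> P1" "(c, u) \<noteq> (b, t)" "(c, u) \<noteq> (a, m)"
          "between a c b" "between m u t"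
          using guardedD2[OF guard1(2) bt 1] \<open>s \<noteq> t\<close> s by metis
        then show ?thesis using s by (intro exI[of _ c] exI[of _ u]) (simp add: points_def)
      next
        case s: 3
        have "between s m t"
          using s t rows by (auto simp: between_iff)
        then show ?thesis using a s rows \<open>a \<noteq> b\<close>
          by (intro exI[of _ a] exI[of _ m]) (auto simp: points_def)
      qed
    next
      case 2
      then show ?thesis by (rule row)
    qed
  qed
qed

lemma first_second_satisfied:
  assumes as: "(a, s) \<in> P1" and bt: "(b, t) \<in> P2" and "s \<noteq> t"
  shows "\<exists>c u. (c, u) \<in> points \<and> (c, u) \<noteq> (a, s) \<and> (c, u) \<noteq> (b, t) \<and> between a c b \<and> between s u t"
proof -
  have a: "a \<in> K1" "between e s m" and b: "b \<in> K2" "between m t f"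
    using P1[OF as] P2[OF bt] by simp_all
  have smt: "between s m t" using a(2) b(2) rows(1) unfolding between_iff by linarith
  obtain c d where c: "c \<in> S" "c \<in> K1" "between a c b" and d: "d \<in> S" "d \<in> K2" "between a d b"
    using boundary[OF a(1) b(1)] by blast
  have "c \<noteq> b" "d \<noteq> a" using a(1) b(1) c(2) d(2) disjoint by blast+
  have in_points: "(c, m) \<in> points" "(d, m) \<in> points" using c(1) d(1) by (simp_all add: points_def)
  \<comment> \<open>The witness must differ from both given points. For \<open>s = m\<close> the
    boundary key of the second input differs from \<open>a\<close>; otherwise that of the first
    input differs from \<open>b\<close>.\<close>
  show ?thesis
  proof (cases "s = m")
    case True
    then show ?thesis using in_points(2) d(3) smt \<open>d \<noteq> a\<close> \<open>s \<noteq> t\<close> by blast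
  next
    case False
    then show ?thesis using in_points(1) c(3) smt \<open>c \<noteq> b\<close> by blast
  qed
qed

lemma top_second_satisfied:
  assumes "a \<in> S" "s \<in> {e, m, f}" "(b, t) \<in> P2" "a \<noteq> b" "s \<noteq> t"
  shows "\<exists>c u. (c, u) \<in> points \<and> (c, u) \<noteq> (a, s) \<and> (c, u) \<noteq> (b, t) \<and> between a c b \<and> between s u t"
  using merge_rows.top_first_satisfied[OF flip, of a s b t] assms flip_points by auto

lemma satisfied_points: "satisfied points"
proof -
  define G where "G a s b t \<longleftrightarrow> (\<exists>c u. (c, u) \<in> points \<and> (c, u) \<noteq> (a, s) \<and> (c, u) \<noteq> (b, t) \<and>
    between a c b \<and> between s u t)" for a s b t
  have sym: "G a s b t" if G: "G b t a s" for a s b t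
  proof -
    obtain c u where "(c, u) \<in> points" "(c, u) \<noteq> (b, t)" "(c, u) \<noteq> (a, s)"
      "between b c a" "between t u s" using G by (auto simp: G_def)
    then show ?thesis unfolding G_def using between_commute[of b c a] between_commute[of t u s]
      by (intro exI[of _ c] exI[of _ u]) simp
  qed
  have inner: "G a s b t"
    if Q: "Q = P1 \<or> Q = P2" and pq: "(a, s) \<in> Q" "(b, t) \<in> Q" "a \<noteq> b" "s \<noteq> t"
    for a s b t Q
  proof -
    have "satisfied Q" "Q \<subseteq> points" using Q sat1 sat2 by (auto simp: points_def)
    then obtain c u where "(c, u) \<in> Q" "(c, u) \<noteq> (a, s)" "(c, u) \<noteq> (b, t)"
      "between a c b" "between s u t" using satisfiedD[of Q a s b t] pq by blast
    then show ?thesis unfolding G_def using \<open>Q \<subseteq> points\<close>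
      by (intro exI[of _ c] exI[of _ u]) auto
  qed
  have tops: "G a s b t" if "a \<in> S" "s \<in> {e, m, f}" "b \<in> S" "t \<in> {e, m, f}" "a \<noteq> b" "s \<noteq> t"
    for a s b t
    unfolding G_def using that by (intro exI[of _ b] exI[of _ s]) (auto simp: points_def)
  have top1: "G a s b t" if "a \<in> S" "s \<in> {e, m, f}" "(b, t) \<in> P1" "a \<noteq> b" "s \<noteq> t" for a s b t
    unfolding G_def using top_first_satisfied[OF that] .
  have top2: "G a s b t" if "a \<in> S" "s \<in> {e, m, f}" "(b, t) \<in> P2" "a \<noteq> b" "s \<noteq> t" for a s b t
    unfolding G_def using top_second_satisfied[OF that] .
  have cross: "G a s b t" if "(a, s) \<in> P1" "(b, t) \<in> P2" "s \<noteq> t" for a s b t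
    unfolding G_def using first_second_satisfied[OF that] .
  have cases: "(a, s) \<in> P1 \<or> (a, s) \<in> P2 \<or> a \<in> S \<and> s \<in> {e, m, f}" if "(a, s) \<in> points" for a s
    using that by (auto simp: points_def)
  have "G a s b t" if as: "(a, s) \<in> points" and bt: "(b, t) \<in> points" and ne: "a \<noteq> b" "s \<noteq> t"
    for a s b t
  proof -
    note ne' = ne(1)[symmetric] ne(2)[symmetric]
    consider "(a, s) \<in> P1" | "(a, s) \<in> P2" | "a \<in> S" "s \<in> {e, m, f}" using cases[OF as] by blast
    then show ?thesis
    proof cases
      case 1
      then show ?thesis using cases[OF bt] inner[OF disjI1[OF refl] 1 _ ne] cross[OF 1 _ ne(2)]
        sym[OF top1[OF _ _ 1 ne']] by blast
    next
      case 2
      then show ?thesis using cases[OF bt] inner[OF disjI2[OF refl] 2 _ ne]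
        sym[OF cross[OF _ 2 ne'(2)]] sym[OF top2[OF _ _ 2 ne']] by blast
    next
      case 3
      then show ?thesis using cases[OF bt] top1[OF 3 _ ne] top2[OF 3 _ ne] tops[OF 3 _ _ ne] by blast
    qed
  qed
  then show ?thesis unfolding satisfied_def G_def by blast
qed

end

text \<open>If neither key is an ancestor of the other, a common ancestor lies strictly between
  them, and being above \<open>a\<close> it belongs to the top tree. The key \<open>b\<close> itself
  cannot be above \<open>a\<close>, since it would then belong to the top tree.\<close>

lemma top_tree_gap:
  assumes "bst t" "cut_top S t = S" "a \<in> S" "b \<in> set_tree t" "b \<notin> S"
  shows "ancestor t a b \<or> (\<exists>c\<in>S. c \<noteq> a \<and> between a c b)"
proof -
  have "a \<in> set_tree t" "a \<noteq> b" using assms cut_top_subset[of S t] by auto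
  then consider "ancestor t a b" | "ancestor t b a"
    | c where "ancestor t c a" "a < c \<and> c < b \<or> b < c \<and> c < a"
    using lowest_common_ancestor[OF assms(1) _ assms(4)] by blast
  then show ?thesis
  proof cases
    case 1
    then show ?thesis by blast
  next
    case 2
    then show ?thesis using cut_top_ancestor_closed[OF assms(1)] assms(2,3,5) by blast
  next
    case 3
    then have "c \<in> S" using cut_top_ancestor_closed[OF assms(1)] assms(2,3) by blast
    then show ?thesis using 3(2) unfolding between_iff by (intro disjI2 bexI[of _ c]) auto
  qed
qed

text \<open>Each clause of a merge pays for a locale assumption: unchanged hanging subtrees for
  \<open>hanging\<close>, block boundaries for \<open>boundary\<close>, connectedness of the top
  trees for \<open>top_closed\<close>, \<open>gap1\<close> and \<open>gap2\<close>.\<close>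

lemma merge_rows_bst_merge:
  fixes TA TB T :: "nat tree"
  assumes "bst TA" "bst TB" "bst T" "set_tree TA \<inter> set_tree TB = {}"
    "set_tree T = set_tree TA \<union> set_tree TB"
    and top: "is_top_tree TA \<tau>a" "is_top_tree TB \<tau>b" "is_top_tree T S" "S = \<tau>a \<union> \<tau>b"
    and hang: "\<forall>s\<in>hanging S T. s \<in> subtrees TA \<or> s \<in> subtrees TB"
    and bounds: "block_bounds (inorder T) (\<lambda>k. k \<in> set_tree TA) \<subseteq> S"
    and rows: "l < m" "m < r"
    and PA: "\<And>b t. (b, t) \<in> PA \<Longrightarrow> b \<in> set_tree TA \<and> l \<le> t \<and> t \<le> m"
      "satisfied PA" "guarded PA (ancestor TA) l" "guarded PA (ancestor TA) m"
    and PB: "\<And>b t. (b, t) \<in> PB \<Longrightarrow> b \<in> set_tree TB \<and> m \<le> t \<and> t \<le> r"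
      "satisfied PB" "guarded PB (ancestor TB) m" "guarded PB (ancestor TB) r"
  shows "merge_rows PA PB (set_tree TA) (set_tree TB) S (ancestor TA) (ancestor TB) (ancestor T) l m r"
proof
  have cut: "cut_top \<tau>a TA = \<tau>a" "cut_top \<tau>b TB = \<tau>b" "cut_top S T = S"
    using top by (simp_all add: is_top_tree_def)
  have sub: "\<tau>a \<subseteq> set_tree TA" "\<tau>b \<subseteq> set_tree TB"
    using cut cut_top_subset[of \<tau>a TA] cut_top_subset[of \<tau>b TB] by auto
  show "between l m r" "l \<noteq> m" "m \<noteq> r" using rows by (auto simp: between_iff)
  show "b \<in> set_tree TA \<and> between l t m" if "(b, t) \<in> PA" for b t
    using PA(1)[OF that] by (simp add: between_iff)
  show "b \<in> set_tree TB \<and> between m t r" if "(b, t) \<in> PB" for b t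
    using PB(1)[OF that] by (simp add: between_iff)
  show "S \<subseteq> set_tree TA \<union> set_tree TB" using sub top(4) by auto
  show "a \<in> set_tree TA \<and> b \<in> set_tree TA" if "ancestor TA a b" for a b
    using ancestor_in_set[OF that] .
  show "a \<in> set_tree TB \<and> b \<in> set_tree TB" if "ancestor TB a b" for a b
    using ancestor_in_set[OF that] .
  show "a \<noteq> b" if "ancestor T a b" for a b using ancestor_neq[OF assms(3) that] .
  show "a \<in> S" if "ancestor T a b" "b \<in> S" for a b
    using cut_top_ancestor_closed[OF assms(3) that(1)] that(2) cut(3) by simp
  show "ancestor TA a b \<or> ancestor TB a b" if "ancestor T a b" "a \<notin> S" for a b
    using ancestor_hanging[OF that] hang ancestor_subtree by metis
  show "\<exists>c\<in>S \<inter> set_tree TA. \<exists>d\<in>S \<inter> set_tree TB. between a c b \<and> between a d b"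
    if ab: "a \<in> set_tree TA" "b \<in> set_tree TB" for a b
  proof -
    let ?f = "\<lambda>k. k \<in> set_tree TA"
    have "sorted_wrt (<) (inorder T)" using assms(3) by (simp add: bst_iff_sorted_wrt_less)
    moreover have "a \<in> set (inorder T)" "b \<in> set (inorder T)" using ab assms(5) by auto
    moreover have "?f a \<noteq> ?f b" using ab assms(4) by auto
    ultimately obtain c d where cd: "c \<in> S" "d \<in> S" "?f c \<noteq> ?f d" "between a c b" "between a d b"
      using block_boundary_between[of "inorder T" a b ?f] bounds by blast
    have "c \<in> set_tree TA \<union> set_tree TB" "d \<in> set_tree TA \<union> set_tree TB"
      using cd(1,2) sub top(4) by auto
    then show ?thesis using cd by (cases "?f c") blast+
  qed
  show "ancestor TA a b \<or> (\<exists>c\<in>S. c \<noteq> a \<and> between a c b)"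
    if "a \<in> S \<inter> set_tree TA" "b \<in> set_tree TA - S" for a b
  proof -
    have "a \<in> \<tau>a" "b \<in> set_tree TA" "b \<notin> \<tau>a" using that sub top(4) assms(4) by auto
    then show ?thesis using top_tree_gap[OF assms(1) cut(1)] top(4) by blast
  qed
  show "ancestor TB a b \<or> (\<exists>c\<in>S. c \<noteq> a \<and> between a c b)"
    if "a \<in> S \<inter> set_tree TB" "b \<in> set_tree TB - S" for a b
  proof -
    have "a \<in> \<tau>b" "b \<in> set_tree TB" "b \<notin> \<tau>b" using that sub top(4) assms(4) by auto
    then show ?thesis using top_tree_gap[OF assms(2) cut(2)] top(4) by blast
  qed
qed (fact assms(4) PA PB)+

section \<open>Points and costs of a whole mergesort\<close>

lemma msort_set: "msort xs T a \<Longrightarrow> set_tree T = set xs"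
  by (induction rule: msort.induct) (auto simp: bst_merge_def)

lemma msort_not_Nil: "msort xs T a \<Longrightarrow> xs \<noteq> []"
  by (induction rule: msort.induct) auto

lemma bst_merge_cost:
  assumes "bst_merge TA TB T c"
  shows "2 \<le> c"
proof -
  obtain \<tau>a \<tau>b where \<tau>: "is_top_tree TA \<tau>a" "is_top_tree TB \<tau>b" "c = card (\<tau>a \<union> \<tau>b)"
    "set_tree TA \<inter> set_tree TB = {}"
    using assms by (auto simp: bst_merge_def)
  have sub: "\<tau>a \<subseteq> set_tree TA" "\<tau>b \<subseteq> set_tree TB"
    using \<tau>(1,2) cut_top_subset[of \<tau>a TA] cut_top_subset[of \<tau>b TB] by (auto simp: is_top_tree_def)
  then have fin: "finite \<tau>a" "finite \<tau>b" using finite_subset finite_set_tree by blast+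
  have "card (\<tau>a \<union> \<tau>b) = card \<tau>a + card \<tau>b"
    using sub \<tau>(4) fin by (intro card_Un_disjoint) auto
  moreover have "card \<tau>a > 0" "card \<tau>b > 0" using fin \<tau>(1,2) by (auto simp: is_top_tree_def card_gt_0_iff)
  ultimately show ?thesis using \<tau>(3) by linarith
qed

text \<open>There is one merge fewer than there are elements, and each touches a key from either
  side. Accesses can therefore absorb terms linear in the input length.\<close>

lemma msort_cost: "msort xs T a \<Longrightarrow> 2 * length xs \<le> a + 2"
proof (induction rule: msort.induct)
  case (merge xs ys TA a TB b T c)
  then show ?case using bst_merge_cost[OF merge.hyps(5)] by simp
qed simp

lemma msort_points:
  assumes "msort xs T a"
  shows "\<exists>P. finite P \<and> satisfied P \<and> guarded P (ancestor T) l \<and>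
    guarded P (ancestor T) (l + length xs) \<and>
    (\<forall>b t. (b, t) \<in> P \<longrightarrow> b \<in> set_tree T \<and> l \<le> t \<and> t \<le> l + length xs) \<and>
    (\<forall>i<length xs. (xs ! i, l + i) \<in> P \<and> (xs ! i, Suc (l + i)) \<in> P) \<and>
    card P \<le> 3 * a + 2 * length xs"
  using assms
proof (induction arbitrary: l rule: msort.induct)
  case (single x)
  show ?case
    \<comment> \<open>A single key has no ancestor pairs, so both guards are void. The point in row
      \<open>l\<close> is the access of a mergesort; the one in row \<open>Suc l\<close> becomes the
      access when a partition sort is transposed.\<close>
    by (rule exI[of _ "{(x, l), (x, Suc l)}"]) (auto simp: satisfied_def guarded_def)
next
  case (merge xs ys TA a TB b T c)
  let ?m = "l + length xs" and ?r = "l + length xs + length ys"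
  obtain PA where PA: "finite PA" "satisfied PA" "guarded PA (ancestor TA) l"
    "guarded PA (ancestor TA) ?m"
    "\<And>b t. (b, t) \<in> PA \<Longrightarrow> b \<in> set_tree TA \<and> l \<le> t \<and> t \<le> ?m"
    "\<And>i. i < length xs \<Longrightarrow> (xs ! i, l + i) \<in> PA \<and> (xs ! i, Suc (l + i)) \<in> PA"
    "card PA \<le> 3 * a + 2 * length xs"
    using merge.IH(1)[of l] by blast
  obtain PB where PB: "finite PB" "satisfied PB" "guarded PB (ancestor TB) ?m"
    "guarded PB (ancestor TB) ?r"
    "\<And>b t. (b, t) \<in> PB \<Longrightarrow> b \<in> set_tree TB \<and> ?m \<le> t \<and> t \<le> ?r"
    "\<And>i. i < length ys \<Longrightarrow> (ys ! i, ?m + i) \<in> PB \<and> (ys ! i, Suc (?m + i)) \<in> PB"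
    "card PB \<le> 3 * b + 2 * length ys"
    using merge.IH(2)[of ?m] by blast
  have T: "set_tree T = set_tree TA \<union> set_tree TB" and bst: "bst TA" "bst TB" "bst T"
    and disj: "set_tree TA \<inter> set_tree TB = {}"
    using merge.hyps(5) by (auto simp: bst_merge_def)
  obtain \<tau>a \<tau>b S where top: "is_top_tree TA \<tau>a" "is_top_tree TB \<tau>b" "is_top_tree T S" "S = \<tau>a \<union> \<tau>b"
    "\<forall>s\<in>hanging S T. s \<in> subtrees TA \<or> s \<in> subtrees TB"
    "block_bounds (inorder T) (\<lambda>k. k \<in> set_tree TA) \<subseteq> S" "c = card S"
    using merge.hyps(5) unfolding bst_merge_def by blast
  have len: "l < ?m" "?m < ?r" using merge.hyps(1,2) by auto
  interpret merge_rows PA PB "set_tree TA" "set_tree TB" S "ancestor TA" "ancestor TB" "ancestor T" l ?m ?r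
    by (rule merge_rows_bst_merge[OF bst disj T top(1-6) len PA(5,2,3,4) PB(5,2,3,4)])
  have "guarded points (ancestor T) ?r"
    using merge_rows.guarded_points[OF flip] flip_points by simp
  moreover have ST: "S \<subseteq> set_tree T"
    using top(3) cut_top_subset[of S T] by (auto simp: is_top_tree_def)
  then have finS: "finite S" using finite_subset finite_set_tree by blast
  have fin: "finite points" using PA(1) PB(1) finS by (simp add: points_def)
  moreover have "card points \<le> 3 * (a + b + c) + 2 * length (xs @ ys)"
  proof -
    have "card points \<le> card PA + card PB + card (S \<times> {l, ?m, ?r})"
      unfolding points_def by (meson card_Un_le add_le_mono1 le_trans)
    moreover have "card (S \<times> {l, ?m, ?r}) = 3 * c"
      using len top(7) by (simp add: card_cartesian_product)
    ultimately show ?thesis using PA(7) PB(7) by simp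
  qed
  moreover have "b' \<in> set_tree T \<and> l \<le> t \<and> t \<le> l + length (xs @ ys)" if "(b', t) \<in> points" for b' t
    using that PA(5)[of b' t] PB(5)[of b' t] ST T by (auto simp: points_def)
  moreover have "((xs @ ys) ! i, l + i) \<in> points \<and> ((xs @ ys) ! i, Suc (l + i)) \<in> points"
    if "i < length (xs @ ys)" for i
  proof (cases "i < length xs")
    case True
    then show ?thesis using PA(6)[of i] by (simp add: points_def nth_append)
  next
    case False
    then show ?thesis using PB(6)[of "i - length xs"] that by (simp add: points_def nth_append)
  qed
  ultimately show ?case using satisfied_points guarded_points
    by (intro exI[of _ points]) (simp add: add.assoc)
qed

section \<open>Partition sort as an inverse mergesort\<close>

lemma set_tree_map_tree: "set_tree (map_tree f t) = f ` set_tree t"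
  by (rule tree.set_map)

lemma subtrees_map_tree: "subtrees (map_tree f t) = map_tree f ` subtrees t"
  by (induction t) auto

lemma cut_top_map_tree:
  assumes "inj_on f (set_tree t \<union> S)"
  shows "cut_top (f ` S) (map_tree f t) = f ` cut_top S t"
  using assms
proof (induction t)
  case Leaf
  then show ?case by simp
next
  case (Node l x r)
  have "inj_on f (set_tree l \<union> S)" "inj_on f (set_tree r \<union> S)"
    using Node.prems by (auto intro: inj_on_subset)
  moreover have "f x \<in> f ` S \<longleftrightarrow> x \<in> S" using Node.prems by (auto simp: inj_on_def)
  ultimately show ?case using Node.IH by (simp add: image_Un)
qed

lemma hanging_map_tree:
  assumes "inj_on f (set_tree t \<union> S)"
  shows "hanging (f ` S) (map_tree f t) = map_tree f ` hanging S t"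
  using assms
proof (induction t)
  case Leaf
  then show ?case by simp
next
  case (Node l x r)
  have "inj_on f (set_tree l \<union> S)" "inj_on f (set_tree r \<union> S)"
    using Node.prems by (auto intro: inj_on_subset)
  moreover have "f x \<in> f ` S \<longleftrightarrow> x \<in> S" using Node.prems by (auto simp: inj_on_def)
  ultimately show ?case using Node.IH by (simp add: image_Un)
qed

lemma is_top_tree_subset: "is_top_tree t S \<Longrightarrow> S \<subseteq> set_tree t"
  using cut_top_subset[of S t] by (auto simp: is_top_tree_def)

lemma is_top_tree_map_tree:
  assumes "inj_on f (set_tree t)" "is_top_tree t S"
  shows "is_top_tree (map_tree f t) (f ` S)"
proof -
  have "set_tree t \<union> S = set_tree t" using is_top_tree_subset[OF assms(2)] by blast
  then show ?thesis using cut_top_map_tree[of f t S] assms by (auto simp: is_top_tree_def)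
qed

lemma block_bounds_map:
  assumes "\<And>x. x \<in> set xs \<Longrightarrow> g' (f x) = g x"
  shows "block_bounds (map f xs) g' \<subseteq> f ` block_bounds xs g"
proof
  fix y assume y: "y \<in> block_bounds (map f xs) g'"
  obtain i where i: "y = f (xs ! i)" "i < length xs"
    "i = 0 \<or> g' (map f xs ! (i - 1)) \<noteq> g' (map f xs ! i) \<or> i = length xs - 1 \<or>
      g' (map f xs ! (i + 1)) \<noteq> g' (map f xs ! i)"
  proof -
    from y obtain i where "y = map f xs ! i" "i < length (map f xs)"
      "i = 0 \<or> g' (map f xs ! (i - 1)) \<noteq> g' (map f xs ! i) \<or> i = length (map f xs) - 1 \<or>
        g' (map f xs ! (i + 1)) \<noteq> g' (map f xs ! i)"
      unfolding block_bounds_def by blast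
    then show thesis using that[of i] by (simp only: length_map nth_map)
  qed
  have g: "g' (map f xs ! j) = g (xs ! j)" if "j < length xs" for j using that assms by simp
  have "i = 0 \<or> g (xs ! (i - 1)) \<noteq> g (xs ! i) \<or> i = length xs - 1 \<or> g (xs ! (i + 1)) \<noteq> g (xs ! i)"
  \<comment> \<open>At the ends a neighbour is missing: \<open>i - 1\<close> is \<open>0\<close>
    again, or \<open>i + 1\<close> is out of range. These positions are boundaries anyway.\<close>
  proof (cases "i = 0 \<or> i = length xs - 1")
    case False
    then have "i - 1 < length xs" "i + 1 < length xs" using i(2) by auto
    then show ?thesis using i(2,3) g by metis
  qed auto
  then have "xs ! i \<in> block_bounds xs g" using i(2) by (auto simp: block_bounds_def)
  then show "y \<in> f ` block_bounds xs g" using i(1) by blast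
qed

lemma subseq_sorted_wrt: "subseq xs ys \<Longrightarrow> sorted_wrt R ys \<Longrightarrow> sorted_wrt R xs"
proof (induction rule: list_emb.induct)
  case (list_emb_Cons2 x y xs ys)
  then show ?case using list_emb_set[of "(=)" xs ys] by fastforce
qed auto

text \<open>Renaming keys to positions turns the left-to-right order of \<open>T\<close> into search
  order. The subsequence condition makes both outputs search trees, and the partition read backwards
  is a merge.\<close>

lemma bt_partition_merge:
  fixes pos :: "nat \<Rightarrow> nat"
  assumes part: "bt_partition T TA TB c" and inj: "inj_on pos (set_tree T)"
    and bst: "bst (map_tree pos T)"
  shows "bst_merge (map_tree pos TA) (map_tree pos TB) (map_tree pos T) c"
proof -
  let ?A = "set_tree TA" and ?B = "set_tree TB"
  have AB: "?A \<inter> ?B = {}" "?A \<union> ?B = set_tree T"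
    and sub: "subseq (inorder TA) (inorder T)" "subseq (inorder TB) (inorder T)"
    using part by (auto simp: bt_partition_def)
  obtain \<tau>a \<tau>b S where S: "is_top_tree TA \<tau>a" "is_top_tree TB \<tau>b" "is_top_tree T S" "S = \<tau>a \<union> \<tau>b"
    "\<forall>s\<in>hanging S T. s \<in> subtrees TA \<or> s \<in> subtrees TB"
    "block_bounds (inorder T) (\<lambda>k. k \<in> ?A) \<subseteq> S" "c = card S"
    using part unfolding bt_partition_def by blast
  have injA: "inj_on pos ?A" and injB: "inj_on pos ?B"
    using inj AB(2) by (auto intro: inj_on_subset)
  have ST: "S \<subseteq> set_tree T" using is_top_tree_subset[OF S(3)] .
  have mem: "pos x \<in> pos ` ?A \<longleftrightarrow> x \<in> ?A" if "x \<in> set_tree T" for x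
    using inj_on_image_mem_iff[OF inj that, of ?A] AB(2) by blast
  have sortedT: "sorted_wrt (<) (map pos (inorder T))"
    using bst by (simp add: bst_iff_sorted_wrt_less inorder_map)
  have "bst (map_tree pos TA)" "bst (map_tree pos TB)"
    using subseq_sorted_wrt[OF subseq_map[OF sub(1)] sortedT]
      subseq_sorted_wrt[OF subseq_map[OF sub(2)] sortedT]
    by (simp_all add: bst_iff_sorted_wrt_less inorder_map)
  moreover have "pos ` ?A \<inter> pos ` ?B = {}"
    using inj_on_image_Int[OF inj, of ?A ?B] AB by auto
  moreover have "pos ` set_tree T = pos ` ?A \<union> pos ` ?B" using AB(2) by (metis image_Un)
  moreover have "hanging (pos ` S) (map_tree pos T) = map_tree pos ` hanging S T"
    using inj ST by (intro hanging_map_tree) (simp add: Un_absorb2)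
  then have "\<forall>s\<in>hanging (pos ` S) (map_tree pos T).
      s \<in> subtrees (map_tree pos TA) \<or> s \<in> subtrees (map_tree pos TB)"
    using S(5) by (auto simp: subtrees_map_tree)
  moreover have "block_bounds (map pos (inorder T)) (\<lambda>k. k \<in> pos ` ?A) \<subseteq> pos ` S"
    using block_bounds_map[of "inorder T" "\<lambda>k. k \<in> pos ` ?A" pos "\<lambda>k. k \<in> ?A"] mem
      image_mono[OF S(6), of pos] by simp
  moreover have "c = card (pos ` S)" using S(7) card_image[OF inj_on_subset[OF inj ST]] by simp
  moreover have "is_top_tree (map_tree pos TA) (pos ` \<tau>a)" "is_top_tree (map_tree pos TB) (pos ` \<tau>b)"
    "is_top_tree (map_tree pos T) (pos ` S)" "pos ` S = pos ` \<tau>a \<union> pos ` \<tau>b"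
    using is_top_tree_map_tree[OF injA S(1)] is_top_tree_map_tree[OF injB S(2)]
      is_top_tree_map_tree[OF inj S(3)] S(4) image_Un[of pos \<tau>a \<tau>b] by simp_all
  ultimately show ?thesis unfolding bst_merge_def set_tree_map_tree inorder_map
    using bst by blast
qed

lemma sorted_list_of_set_Un:
  fixes A B :: "'a::linorder set"
  assumes "finite A" "finite B" "\<forall>a\<in>A. \<forall>b\<in>B. a < b"
  shows "sorted_list_of_set (A \<union> B) = sorted_list_of_set A @ sorted_list_of_set B"
  using assms by (intro sorted_distinct_set_unique) (auto simp: sorted_append less_imp_le)

text \<open>Exchanging the roles of keys and positions turns a partition sort into a mergesort of the
  inverse permutation.\<close>

lemma psort_msort:
  fixes pos :: "nat \<Rightarrow> nat"
  assumes "psort T a" "inj_on pos (set_tree T)" "bst (map_tree pos T)"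
  shows "msort (map pos (sorted_list_of_set (set_tree T))) (map_tree pos T) a"
  using assms
proof (induction rule: psort.induct)
  case (single x)
  then show ?case by (simp add: msort.single)
next
  case (split T TA TB c k a b)
  have AB: "set_tree T = set_tree TA \<union> set_tree TB" "TA \<noteq> Leaf" "TB \<noteq> Leaf"
    using split.hyps(1) by (auto simp: bt_partition_def)
  note merge = bt_partition_merge[OF split.hyps(1) split.prems]
  have "bst (map_tree pos TA)" "bst (map_tree pos TB)" using merge by (auto simp: bst_merge_def)
  moreover have "inj_on pos (set_tree TA)" "inj_on pos (set_tree TB)"
    using split.prems(1) AB(1) by (auto intro: inj_on_subset)
  ultimately have "msort (map pos (sorted_list_of_set (set_tree TA))) (map_tree pos TA) a"
    "msort (map pos (sorted_list_of_set (set_tree TB))) (map_tree pos TB) b"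
    using split.IH by auto
  from msort.merge[OF _ _ this merge] this[THEN msort_not_Nil]
  have "msort (map pos (sorted_list_of_set (set_tree TA)) @ map pos (sorted_list_of_set (set_tree TB)))
      (map_tree pos T) (a + b + c)" by blast
  moreover have "sorted_list_of_set (set_tree T) =
      sorted_list_of_set (set_tree TA) @ sorted_list_of_set (set_tree TB)"
    unfolding AB(1) using split.hyps(2,3) by (intro sorted_list_of_set_Un) (auto intro: less_le_trans)
  ultimately show ?case by simp
qed

section \<open>The linear bounds and their constant\<close>

lemma OPT_BST_singleton: "OPT_BST [x] = 0"
proof -
  have "bst_search (Node Leaf x Leaf) x (Node Leaf x Leaf) (0 + 0)"
    by (rule bst_search_intro[where s = "(Node Leaf x Leaf, [])"]) auto
  then have "bst_serves (Node Leaf x Leaf) [x] (0 + 0)"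
    by (intro bst_serves.intros) auto
  then have "\<exists>t. bst t \<and> set_tree t = set [x] \<and> bst_serves t [x] 0"
    by (intro exI[of _ "Node Leaf x Leaf"]) simp
  then have "OPT_BST [x] \<le> 0" unfolding OPT_BST_def by (rule Least_le)
  then show ?thesis by simp
qed

text \<open>A single element may come with \<open>a = 0\<close>, so there the optimum has to vanish
  exactly. From two elements on, \<open>a\<close> is at least 2, so \<open>card P\<close> is at most
  \<open>4 * a + 2\<close> and hence at most \<open>5 * a\<close>; each point costs 10
  actions.\<close>

lemma OPT_BST_le_of_points:
  assumes "satisfied P" "finite P" "fst ` P \<subseteq> set xs"
    "\<And>i. i < length xs \<Longrightarrow> (xs ! i, i) \<in> P"
    and card: "card P \<le> 3 * a + 2 * length xs" and cost: "2 * length xs \<le> a + 2"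
    and "xs \<noteq> []"
  shows "OPT_BST xs \<le> 50 * a"
proof (cases "length xs = 1")
  case True
  then obtain x where "xs = [x]" by (auto simp: length_Suc_conv)
  then show ?thesis by (simp add: OPT_BST_singleton)
next
  case False
  then have "length xs \<ge> 2" using \<open>xs \<noteq> []\<close> by (cases xs) (auto simp: Suc_le_eq)
  then have "card P \<le> 5 * a" using card cost by linarith
  then show ?thesis using OPT_BST_le_satisfied[OF assms(1-4)] by linarith
qed

lemma OPT_BST_le_msort:
  assumes "msort xs T a"
  shows "OPT_BST xs \<le> 50 * a"
proof -
  obtain P where P: "finite P" "satisfied P" "\<forall>b t. (b, t) \<in> P \<longrightarrow> b \<in> set_tree T"
    "\<forall>i<length xs. (xs ! i, 0 + i) \<in> P" "card P \<le> 3 * a + 2 * length xs"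
    using msort_points[OF assms, of 0] by blast
  show ?thesis
    using P msort_set[OF assms] msort_cost[OF assms] msort_not_Nil[OF assms]
    by (intro OPT_BST_le_of_points[of P]) auto
qed

lemma OPT_BST_le_psort:
  assumes "distinct xs" "set xs = {1..n}" "inorder T = xs" "psort T a"
  shows "OPT_BST xs \<le> 50 * a"
proof -
  have len: "length xs = n" using assms(1,2) distinct_card by fastforce
  define pos where "pos k = (THE i. i < n \<and> xs ! i = k)" for k
  have pos_nth: "pos (xs ! i) = i" if "i < n" for i
    unfolding pos_def using that assms(1) len by (auto simp: nth_eq_iff_index_eq)
  have nth_pos: "xs ! pos k = k" if k: "k \<in> {1..n}" for k
  proof -
    obtain i where "i < n" "xs ! i = k" using k assms(2) len by (metis in_set_conv_nth)
    then show ?thesis using pos_nth by auto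
  qed
  have T: "set_tree T = {1..n}" using assms(2,3) by (metis set_inorder)
  have "inj_on pos (set_tree T)" unfolding T by (metis nth_pos inj_onI)
  moreover have "map pos xs = [0..<n]" using pos_nth len by (intro nth_equalityI) auto
  then have "bst (map_tree pos T)"
    using assms(3) by (simp add: bst_iff_sorted_wrt_less inorder_map)
  ultimately have ms: "msort (map pos (sorted_list_of_set {1..n})) (map_tree pos T) a"
    using psort_msort[OF assms(4)] T by simp
  define ys where "ys = map pos (sorted_list_of_set {1..n})"
  have sl: "sorted_list_of_set {1..n} = [1..<Suc n]"
    by (metis atLeastLessThanSuc_atLeastAtMost sorted_list_of_set_range)
  have ys: "length ys = n" "\<And>i. i < n \<Longrightarrow> ys ! i = pos (Suc i)"
    unfolding ys_def sl by (simp_all del: upt_Suc)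
  obtain P where P: "finite P" "satisfied P"
    "\<forall>i<length ys. (ys ! i, 0 + i) \<in> P \<and> (ys ! i, Suc (0 + i)) \<in> P" "card P \<le> 3 * a + 2 * length ys"
    using msort_points[OF ms[folded ys_def], of 0] by blast
  \<comment> \<open>Rows of \<open>P\<close> become keys. They run from 0 to \<open>n\<close>, and
    row 0 is no key.\<close>
  define Q where "Q = {(k, i). (i, k) \<in> P \<and> 1 \<le> k \<and> k \<le> n}"
  have "satisfied Q" unfolding Q_def by (rule satisfied_transpose_restrict[OF P(2)])
  moreover have Q: "Q \<subseteq> prod.swap ` P" by (force simp: Q_def)
  have "finite Q" using finite_subset[OF Q] P(1) by simp
  moreover have "card Q \<le> card P" using surj_card_le[OF P(1) Q] .
  moreover have "fst ` Q \<subseteq> set xs" unfolding assms(2) by (auto simp: Q_def)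
  moreover have "(xs ! i, i) \<in> Q" if "i < length xs" for i
  proof -
    have k: "xs ! i \<in> {1..n}" using nth_mem[OF that] assms(2) by simp
    then have lt: "xs ! i - 1 < n" and Suc: "Suc (xs ! i - 1) = xs ! i" by auto
    \<comment> \<open>Of the two points of this element the later one is taken, so that the row
      number equals the key.\<close>
    have "(ys ! (xs ! i - 1), xs ! i) \<in> P" using P(3)[rule_format, of "xs ! i - 1"] ys(1) lt Suc by simp
    moreover have "ys ! (xs ! i - 1) = pos (xs ! i)" using ys(2)[OF lt] Suc by simp
    ultimately show ?thesis using pos_nth that len k by (simp add: Q_def)
  qed
  ultimately show ?thesis
    using P(4) msort_cost[OF ms[folded ys_def]] msort_not_Nil[OF ms[folded ys_def]] len ys(1)
    by (intro OPT_BST_le_of_points[of Q]) auto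
qed

theorem theorem1:
  "\<exists>C::real. \<forall>(n::nat) (\<pi>::nat list).
     distinct \<pi> \<and> set \<pi> = {1..n} \<longrightarrow>
       (\<forall>T a. msort \<pi> T a \<longrightarrow> real (OPT_BST \<pi>) \<le> C * real a) \<and>
       (\<forall>T a. inorder T = \<pi> \<and> psort T a \<longrightarrow> real (OPT_BST \<pi>) \<le> C * real a)"
proof (intro exI allI impI conjI)
  fix n :: nat and \<pi> :: "nat list" and T a
  assume \<pi>: "distinct \<pi> \<and> set \<pi> = {1..n}"
  have real: "real (OPT_BST \<pi>) \<le> 50 * real a" if "OPT_BST \<pi> \<le> 50 * a"
    using that by linarith
  show "real (OPT_BST \<pi>) \<le> 50 * real a" if "msort \<pi> T a"
    using real OPT_BST_le_msort[OF that] by blast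
  show "real (OPT_BST \<pi>) \<le> 50 * real a" if "inorder T = \<pi> \<and> psort T a"
    using real OPT_BST_le_psort[of \<pi> n T a] \<pi> that by blast
qed

end
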